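(* For any finite graph $K$ there is an embedding $f:K\to\mathbb{R}^3$ such that for any two disjoint (i.e. having no common vertices) cycles $C_1, C_2$ of length $3$ in $K$ the linking number of $f(C_1)$ and $f(C_2)$ is non-zero.
   Context: Graphs are finite, and each edge joins a pair of distinct vertices. An embedding $f:K\to\mathbb{R}^3$ of a graph $K$ is a piecewise-linear drawing without self-intersections. That is, it assigns to the vertices of $K$ pairwise distinct points of $\mathbb{R}^3$, and to every edge a non-self-intersecting polygonal line joining the points assigned to its endpoints, so that no polygonal line assigned to an edge intersects the interior of the polygonal line assigned to any other edge. For a cycle $C$ in $K$, the image $f(C)$ is the closed non-self-intersecting polygonal line which is the union of the polygonal lines assigned to the edges of $C$. Images of disjoint cycles are disjoint. Linking number. Let $(L_1,L_2)$ be an ordered pair of disjoint oriented closed non-self-intersecting polygonal lines in $\mathbb{R}^3$. Take a generic projection of $L_1\cup L_2$ to a plane. Generic means the following: the projections of the vertices are pairwise distinct; any two segments of the projected polygonal lines either are disjoint, or intersect at their common endpoint, or intersect at a common interior point (called a crossing); and no three interiors of segments have a common point. At every crossing record which segment passes over and which passes under. For an ordered pair $(\overrightarrow{AB},\overrightarrow{CD})$ of oriented segments in the plane crossing at an interior point, its sign is $+1$ if the triangle $ABC$ is oriented clockwise and $-1$ otherwise. The linking number $\operatorname{lk}(L_1,L_2)\in\mathbb{Z}$ is the sum of the signs over all crossings at which $L_1$ passes above $L_2$, where at each such crossing the first vector is the oriented segment of $L_1$ and the second vector is the oriented segment of $L_2$. This integer does not depend on the choice of the generic projection. Switching the two components preserves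 it, and reversing the orientation of one component negates it. Hence whether it is non-zero does not depend on the order or the orientations of the two cycles. *)

theory Defs
  imports "HOL-Analysis.Analysis"
begin

section \<open>Finite graphs and cycles\<close>

text \<open>Loops are excluded, parallel edges are not: an edge is an abstract element \<open>e\<close> and
  \<open>ends e\<close> is the set of its two endpoints.  The choice \<open>ends = id\<close> gives simple graphs.\<close>

definition finite_graph :: "'v set \<Rightarrow> 'e set \<Rightarrow> ('e \<Rightarrow> 'v set) \<Rightarrow> bool" where
  "finite_graph V E ends \<longleftrightarrow>
     finite V \<and> finite E \<and> (\<forall>e\<in>E. ends e \<subseteq> V \<and> card (ends e) = 2)"

text \<open>The cycle visits the vertices \<open>vs\<close> in this order; the edge \<open>es ! i\<close> leads from \<open>vs ! i\<close>
  to the cyclically next vertex.  So each cycle is described together with an orientation and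
  a starting vertex.\<close>

definition graph_cycle ::
    "'v set \<Rightarrow> 'e set \<Rightarrow> ('e \<Rightarrow> 'v set) \<Rightarrow> 'v list \<Rightarrow> 'e list \<Rightarrow> bool" where
  "graph_cycle V E ends vs es \<longleftrightarrow>
     2 \<le> length vs \<and> length es = length vs \<and> distinct vs \<and> distinct es \<and>
     set vs \<subseteq> V \<and> set es \<subseteq> E \<and>
     (\<forall>i<length vs. ends (es ! i) = {vs ! i, vs ! (Suc i mod length vs)})"

section \<open>Polygonal lines and embeddings\<close>

text \<open>The polygonal line through the listed points.  It is constant, hence not an \<open>arc\<close>, if
  the list has fewer than two entries.\<close>

fun polyline :: "(real^3) list \<Rightarrow> real \<Rightarrow> real^3" where
  "polyline [] = linepath 0 0"
| "polyline [p] = linepath p p"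
| "polyline [p, q] = linepath p q"
| "polyline (p # q # r # ps) = linepath p q +++ polyline (q # r # ps)"

definition polyline_interior :: "(real^3) list \<Rightarrow> (real^3) set" where
  "polyline_interior ps = path_image (polyline ps) - {hd ps, last ps}"

text \<open>The last conjunct matters only for isolated vertices; for the other vertices
  it follows from the preceding ones.\<close>

definition graph_embedding ::
    "'v set \<Rightarrow> 'e set \<Rightarrow> ('e \<Rightarrow> 'v set) \<Rightarrow> ('v \<Rightarrow> real^3) \<Rightarrow> ('e \<Rightarrow> (real^3) list) \<Rightarrow> bool" where
  "graph_embedding V E ends pt pl \<longleftrightarrow>
     inj_on pt V \<and>
     (\<forall>e\<in>E. arc (polyline (pl e)) \<and> {hd (pl e), last (pl e)} = pt ` ends e) \<and>
     (\<forall>e\<in>E. \<forall>e'\<in>E. e \<noteq> e' \<longrightarrow>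
        path_image (polyline (pl e)) \<inter> polyline_interior (pl e') = {}) \<and>
     (\<forall>v\<in>V. \<forall>e\<in>E. pt v \<notin> polyline_interior (pl e))"

text \<open>Closed polygonal lines are given by the cyclic list of their vertices, without
  repeating the first one at the end.\<close>

definition line_from :: "('v \<Rightarrow> real^3) \<Rightarrow> ('e \<Rightarrow> (real^3) list) \<Rightarrow> 'v \<Rightarrow> 'e \<Rightarrow> (real^3) list" where
  "line_from pt pl v e = (if hd (pl e) = pt v then pl e else rev (pl e))"

definition cycle_image ::
    "('v \<Rightarrow> real^3) \<Rightarrow> ('e \<Rightarrow> (real^3) list) \<Rightarrow> 'v list \<Rightarrow> 'e list \<Rightarrow> (real^3) list" where
  "cycle_image pt pl vs es = concat (map2 (\<lambda>v e. butlast (line_from pt pl v e)) vs es)"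

definition sides :: "(real^3) list \<Rightarrow> ((real^3) \<times> (real^3)) set" where
  "sides L = set (zip L (rotate1 L))"

section \<open>Generic projections and the linking number\<close>

text \<open>A projection to a plane is given by an orthonormal basis \<open>(a, b)\<close> of the plane.  The
  plane is viewed from the side of \<open>cross3 a b\<close>, so that \<open>a, b\<close> and the upward direction form
  a right-handed frame and the plane has its usual orientation for the viewer.\<close>

type_synonym plane_frame = "(real^3) \<times> (real^3)"

definition orthonormal_frame :: "plane_frame \<Rightarrow> bool" where
  "orthonormal_frame F \<longleftrightarrow> norm (fst F) = 1 \<and> norm (snd F) = 1 \<and> fst F \<bullet> snd F = 0"

definition proj :: "plane_frame \<Rightarrow> real^3 \<Rightarrow> real \<times> real" where
  "proj F x = (x \<bullet> fst F, x \<bullet> snd F)"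

definition height :: "plane_frame \<Rightarrow> real^3 \<Rightarrow> real" where
  "height F x = x \<bullet> cross3 (fst F) (snd F)"

definition proj_segment :: "plane_frame \<Rightarrow> (real^3) \<times> (real^3) \<Rightarrow> (real \<times> real) set" where
  "proj_segment F s = closed_segment (proj F (fst s)) (proj F (snd s))"

definition proj_interior :: "plane_frame \<Rightarrow> (real^3) \<times> (real^3) \<Rightarrow> (real \<times> real) set" where
  "proj_interior F s = open_segment (proj F (fst s)) (proj F (snd s))"

definition proj_ends :: "plane_frame \<Rightarrow> (real^3) \<times> (real^3) \<Rightarrow> (real \<times> real) set" where
  "proj_ends F s = {proj F (fst s), proj F (snd s)}"

definition generic_projection :: "plane_frame \<Rightarrow> (real^3) list \<Rightarrow> (real^3) list \<Rightarrow> bool" where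
  "generic_projection F L1 L2 \<longleftrightarrow>
     orthonormal_frame F \<and>
     inj_on (proj F) (set L1 \<union> set L2) \<and>
     (\<forall>s \<in> sides L1 \<union> sides L2. \<forall>t \<in> sides L1 \<union> sides L2. s \<noteq> t \<longrightarrow>
        proj_segment F s \<inter> proj_segment F t = {} \<or>
        (\<exists>p \<in> proj_ends F s \<inter> proj_ends F t. proj_segment F s \<inter> proj_segment F t = {p}) \<or>
        (\<exists>p \<in> proj_interior F s \<inter> proj_interior F t.
            proj_segment F s \<inter> proj_segment F t = {p})) \<and>
     (\<forall>r \<in> sides L1 \<union> sides L2. \<forall>s \<in> sides L1 \<union> sides L2. \<forall>t \<in> sides L1 \<union> sides L2.
        r \<noteq> s \<and> s \<noteq> t \<and> r \<noteq> t \<longrightarrow>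
        proj_interior F r \<inter> proj_interior F s \<inter> proj_interior F t = {})"

definition passes_over ::
    "plane_frame \<Rightarrow> (real^3) \<times> (real^3) \<Rightarrow> (real^3) \<times> (real^3) \<Rightarrow> bool" where
  "passes_over F s t \<longleftrightarrow>
     (\<exists>x \<in> open_segment (fst s) (snd s). \<exists>y \<in> open_segment (fst t) (snd t).
        proj F x = proj F y \<and> height F x > height F y)"

definition clockwise :: "real \<times> real \<Rightarrow> real \<times> real \<Rightarrow> real \<times> real \<Rightarrow> bool" where
  "clockwise A B C \<longleftrightarrow>
     (fst B - fst A) * (snd C - snd A) - (snd B - snd A) * (fst C - fst A) < 0"

definition crossing_sign ::
    "plane_frame \<Rightarrow> (real^3) \<times> (real^3) \<Rightarrow> (real^3) \<times> (real^3) \<Rightarrow> int" where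
  "crossing_sign F s t =
     (if clockwise (proj F (fst s)) (proj F (snd s)) (proj F (fst t)) then 1 else - 1)"

definition crossing_sum :: "plane_frame \<Rightarrow> (real^3) list \<Rightarrow> (real^3) list \<Rightarrow> int" where
  "crossing_sum F L1 L2 =
     (\<Sum>(s, t) \<in> {(s, t). s \<in> sides L1 \<and> t \<in> sides L2 \<and> passes_over F s t}. crossing_sign F s t)"

text \<open>For disjoint closed non-self-intersecting polygonal lines a generic projection exists
  and the sum does not depend on it; the choice below is harmless.\<close>

definition linking_number :: "(real^3) list \<Rightarrow> (real^3) list \<Rightarrow> int" where
  "linking_number L1 L2 = crossing_sum (SOME F. generic_projection F L1 L2) L1 L2"

end

theory Submission
  imports Defs "HOL-Library.Nat_Bijection"
begin

text \<open>All vertices of the polygonal lines are placed on the moment curve \<open>(t, t\<^sup>2, t\<^sup>3)\<close>.  Any four of its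
  points are affinely independent, so every choice of polygonal lines with different inner vertices is
  an embedding, and the crossings in the vertical projection depend only on the order of the
  parameters.  The lines of the edges are routed such that for edges \<open>e\<close>, \<open>e'\<close> without common vertices
  the signed number of crossings of \<open>e\<close> over \<open>e'\<close> is \<open>20 * 2 ^ key e e'\<close> up to an error of at most 2,
  with different keys for different unordered pairs of edges.  The linking number of two disjoint triangles is, up to sign, a sum of nine
  such numbers with signs, and a signed sum of different powers of 2 does not vanish.

  The linking number is defined by an arbitrary generic projection.  It is independent of the
  projection: crossings seen along \<open>n\<close> and \<open>m\<close> are compared by following a line through the polytope of all
  \<open>(x, y, l, k)\<close> such that the difference of the points with parameters \<open>x\<close>, \<open>y\<close> on two sides is \<open>l n + k m\<close>.\<close>

section \<open>Independence of the linking number from the projection\<close>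

text \<open>Each edge lies in many triangles, so the signs with which its crossings enter the
  linking numbers cannot be fixed in advance; this is why the crossing numbers must resist every
  choice of signs. A gadget controls only the crossings of an earlier route over a later one. The
  opposite number is not prescribed, but exchanging two disjoint routes changes the count by a term
  that depends on their four ends alone and is at most 2 in absolute value. Nine pairs give an error
  of at most 18, and 20 is chosen to exceed it.

  On the moment curve the determinants that decide a vertical crossing are Vandermonde products, so
  routing becomes a problem about the order of numbers. Genericity is more than order: three chords
  of a parabola may be concurrent, and the doubly exponential parameters exclude this.

  The passage from one direction to another needs both in general position to all pairs of sides.
  All that is taken from a generic projection is that no vertex of one polygon is seen on a side of
  the other; a small perturbation that changes no crossing closes the gap.\<close>

text \<open>The region where all functions \<open>\<alpha> i + \<tau> * c i\<close> are positive is an interval, bounded on both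
  sides; it is entered through one facet (\<open>c i > 0\<close>) and left through one facet (\<open>c i < 0\<close>).\<close>

lemma signed_boundary_hits:
  fixes \<alpha> c :: "'i \<Rightarrow> real"
  assumes fin: "finite I"
    and nz: "\<And>i. i \<in> I \<Longrightarrow> c i \<noteq> 0"
    and generic: "\<And>i j \<tau>. \<lbrakk>i \<in> I; j \<in> I; i \<noteq> j; \<alpha> i + \<tau> * c i = 0\<rbrakk> \<Longrightarrow> \<alpha> j + \<tau> * c j \<noteq> 0"
    and pos: "\<exists>i\<in>I. 0 < c i" and neg: "\<exists>i\<in>I. c i < 0"
  shows "(\<Sum>i\<in>I. sgn (c i) *
      of_bool (\<exists>\<tau>. \<alpha> i + \<tau> * c i = 0 \<and> (\<forall>j\<in>I - {i}. 0 < \<alpha> j + \<tau> * c j))) = 0"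
proof -
  define t where "t i = - \<alpha> i / c i" for i
  \<comment> \<open>\<open>lo\<close> is the time of the last entry and \<open>hi\<close> that of
    the first exit, so all functions are positive exactly for \<open>\<tau>\<close> strictly between
    them. If \<open>lo < hi\<close>, the facets of \<open>p\<close> and \<open>q\<close> are both
    hit; otherwise none is.\<close>
  define lo where "lo = Max (t ` {i\<in>I. 0 < c i})"
  define hi where "hi = Min (t ` {i\<in>I. c i < 0})"
  have zero_iff: "\<alpha> i + \<tau> * c i = 0 \<longleftrightarrow> \<tau> = t i" if "i \<in> I" for i \<tau>
    using nz[OF that] by (auto simp: t_def field_simps)
  have inj: "t i \<noteq> t j" if "i \<in> I" "j \<in> I" "i \<noteq> j" for i j
    using generic[OF that, of "t i"] zero_iff that by auto
  have pos_iff: "0 < \<alpha> j + \<tau> * c j \<longleftrightarrow> (0 < c j \<longrightarrow> t j < \<tau>) \<and> (c j < 0 \<longrightarrow> \<tau> < t j)"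
    if "j \<in> I" for j \<tau>
    using nz[OF that] by (auto simp: t_def field_simps)
  have fp: "finite (t ` {i\<in>I. 0 < c i})" "t ` {i\<in>I. 0 < c i} \<noteq> {}"
    and fn: "finite (t ` {i\<in>I. c i < 0})" "t ` {i\<in>I. c i < 0} \<noteq> {}"
    using fin pos neg by auto
  obtain p where p: "p \<in> I" "0 < c p" "t p = lo"
    using Max_in[OF fp] unfolding lo_def by fastforce
  obtain q where q: "q \<in> I" "c q < 0" "t q = hi"
    using Min_in[OF fn] unfolding hi_def by fastforce
  have le_lo: "t i \<le> lo" if "i \<in> I" "0 < c i" for i
    unfolding lo_def using fp that by (intro Max_ge) auto
  have hi_le: "hi \<le> t i" if "i \<in> I" "c i < 0" for i
    unfolding hi_def using fn that by (intro Min_le) auto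
  have "p \<noteq> q" using p q by auto
  have hit: "(\<exists>\<tau>. \<alpha> i + \<tau> * c i = 0 \<and> (\<forall>j\<in>I - {i}. 0 < \<alpha> j + \<tau> * c j))
      \<longleftrightarrow> (i = p \<or> i = q) \<and> lo < hi" (is "?hit i \<longleftrightarrow> _") if i: "i \<in> I" for i
  proof -
    have 1: "?hit i \<longleftrightarrow> (\<forall>j\<in>I - {i}. (0 < c j \<longrightarrow> t j < t i) \<and> (c j < 0 \<longrightarrow> t i < t j))"
      using zero_iff[OF i] pos_iff by auto
    show ?thesis unfolding 1
    proof
      assume H: "\<forall>j\<in>I - {i}. (0 < c j \<longrightarrow> t j < t i) \<and> (c j < 0 \<longrightarrow> t i < t j)"
      show "(i = p \<or> i = q) \<and> lo < hi"
      proof (cases "0 < c i")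
        case True
        then have "i = p" using H p le_lo[OF i True] by force
        then show ?thesis using H p q \<open>p \<noteq> q\<close> by auto
      next
        case False
        then have "c i < 0" using nz[OF i] by auto
        then have "i = q" using H q hi_le[OF i] by force
        then show ?thesis using H p q \<open>p \<noteq> q\<close> by auto
      qed
    next
      assume H: "(i = p \<or> i = q) \<and> lo < hi"
      show "\<forall>j\<in>I - {i}. (0 < c j \<longrightarrow> t j < t i) \<and> (c j < 0 \<longrightarrow> t i < t j)"
        using H p q le_lo hi_le inj by (smt (verit) DiffE insertI1)
    qed
  qed
  have "(\<Sum>i\<in>I. sgn (c i) *
      of_bool (\<exists>\<tau>. \<alpha> i + \<tau> * c i = 0 \<and> (\<forall>j\<in>I - {i}. 0 < \<alpha> j + \<tau> * c j)))
     = (\<Sum>i\<in>I. sgn (c i) * of_bool ((i = p \<or> i = q) \<and> lo < hi))"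
    using hit by (intro sum.cong) auto
  also have "\<dots> = (\<Sum>i\<in>{p,q}. sgn (c i) * of_bool (lo < hi))"
    using p q fin by (intro sum.mono_neutral_cong_right) auto
  also have "\<dots> = 0" using p q \<open>p \<noteq> q\<close> by simp
  finally show ?thesis .
qed

abbreviation triple :: "real^3 \<Rightarrow> real^3 \<Rightarrow> real^3 \<Rightarrow> real" where
  "triple x y z \<equiv> x \<bullet> cross3 y z"

lemmas coordinates_3 = cross3_def inner_vec_def sum_3 vector_3 vec_eq_iff forall_3

text \<open>Passing over, expressed by the viewing direction alone: \<open>n\<close> plays the role
  of the upward normal of the plane of projection.\<close>

definition hits :: "real^3 \<Rightarrow> (real^3) \<times> (real^3) \<Rightarrow> (real^3) \<times> (real^3) \<Rightarrow> bool" where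
  "hits n s t \<longleftrightarrow> (\<exists>x y l. 0 < x \<and> x < 1 \<and> 0 < y \<and> y < 1 \<and> 0 < l \<and>
     (fst s - fst t) + x *\<^sub>R (snd s - fst s) - y *\<^sub>R (snd t - fst t) = l *\<^sub>R n)"

text \<open>Up to orientation, six times the volume of the tetrahedron spanned by the two sides. No
  direction is involved, and yet at every crossing with \<open>s\<close> on top its sign is the
  crossing sign (\<open>crossing_sign_eq\<close>).\<close>

definition side_det :: "(real^3) \<times> (real^3) \<Rightarrow> (real^3) \<times> (real^3) \<Rightarrow> real" where
  "side_det s t = triple (fst s - fst t) (snd s - fst s) (snd t - fst t)"

text \<open>The segment from \<open>r\<close> to \<open>r + v\<close> crosses the open sector
  spanned by \<open>n\<close> and \<open>m\<close>. For differences of a vertex and the points of a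
  side this is the event that the two get in line while the viewing direction turns from
  \<open>n\<close> to \<open>m\<close>.\<close>

definition edge_hits :: "real^3 \<Rightarrow> real^3 \<Rightarrow> real^3 \<Rightarrow> real^3 \<Rightarrow> bool" where
  "edge_hits n m r v \<longleftrightarrow> (\<exists>y l k. 0 < y \<and> y < 1 \<and> 0 < l \<and> 0 < k \<and> r + y *\<^sub>R v = l *\<^sub>R n + k *\<^sub>R m)"

text \<open>The linear relation of four vectors of 3-space behind Cramer's rule. It is kept free of
  denominators because it is also applied where \<open>triple u w n\<close> vanishes.\<close>

lemma cramer_numerators:
  fixes r u w n :: "real^3"
  shows "triple u w n *\<^sub>R r - triple r w n *\<^sub>R u + triple r u n *\<^sub>R w = triple r u w *\<^sub>R n"
  by (auto simp: coordinates_3 algebra_simps)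

lemma cramer_expansion:
  fixes r u w n :: "real^3"
  assumes "triple u w n \<noteq> 0"
  shows "r + (- triple r w n / triple u w n) *\<^sub>R u - (- triple r u n / triple u w n) *\<^sub>R w
    = (triple r u w / triple u w n) *\<^sub>R n"
proof -
  have "triple u w n *\<^sub>R (r + (- triple r w n / triple u w n) *\<^sub>R u - (- triple r u n / triple u w n) *\<^sub>R w)
    = triple u w n *\<^sub>R ((triple r u w / triple u w n) *\<^sub>R n)"
    using cramer_numerators[of u w n r] assms by (simp add: algebra_simps)
  then show ?thesis using real_vector.scale_left_imp_eq[OF assms] by blast
qed

text \<open>Apply \<open>signed_boundary_hits\<close> to the line \<open>{(x, y, l, k). r + x u - y w = l n + k m}\<close>
  and the polytope \<open>0 \<le> x \<le> 1\<close>, \<open>0 \<le> y \<le> 1\<close>, \<open>l \<ge> 0\<close>, \<open>k \<ge> 0\<close>.  The facets \<open>k = 0\<close> and \<open>l = 0\<close> are the crossings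
  seen along \<open>n\<close> and along \<open>m\<close>; each of the other four facets involves one endpoint of a side and the
  whole other side, so that these contributions telescope around closed polygons.\<close>

lemma quad_boundary:
  fixes r u w n m :: "real^3"
  assumes d: "triple r u w \<noteq> 0"
   and n: "triple r w n \<noteq> 0" "triple (r+u) w n \<noteq> 0" "triple r u n \<noteq> 0" "triple (r-w) u n \<noteq> 0" "triple u w n \<noteq> 0"
   and m: "triple r w m \<noteq> 0" "triple (r+u) w m \<noteq> 0" "triple r u m \<noteq> 0" "triple (r-w) u m \<noteq> 0" "triple u w m \<noteq> 0"
   and nm: "triple r n m \<noteq> 0" "triple (r+u) n m \<noteq> 0" "triple (r-w) n m \<noteq> 0" "triple (r+u-w) n m \<noteq> 0"
       "triple u n m \<noteq> 0" "triple w n m \<noteq> 0"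
  shows "sgn (triple w n m) * (of_bool (edge_hits n m r (-w)) - of_bool (edge_hits n m (r+u) (-w)))
     + sgn (triple u n m) * (of_bool (edge_hits n m r u) - of_bool (edge_hits n m (r-w) u))
     + sgn (triple u w n) * of_bool (\<exists>x y l. 0 < x \<and> x < 1 \<and> 0 < y \<and> y < 1 \<and> 0 < l \<and> r + x *\<^sub>R u - y *\<^sub>R w = l *\<^sub>R n)
     = sgn (triple u w m) * of_bool (\<exists>x y l. 0 < x \<and> x < 1 \<and> 0 < y \<and> y < 1 \<and> 0 < l \<and> r + x *\<^sub>R u - y *\<^sub>R w = l *\<^sub>R m)"
proof -
  \<comment> \<open>The line is parametrized from its point with \<open>k = 0\<close>, which
    Cramer's rule provides. Its direction \<open>(cx, cy, cl, D)\<close> consists of the signed 3 by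
    3 minors of \<open>u\<close>, \<open>w\<close>, \<open>n\<close>, \<open>m\<close>.\<close>
  define D where "D = triple u w n"
  define x0 where "x0 = - triple r w n / D"
  define y0 where "y0 = - triple r u n / D"
  define l0 where "l0 = triple r u w / D"
  define cx where "cx = triple w n m"
  define cy where "cy = triple u n m"
  define cl where "cl = - triple u w m"
  define X where "X \<tau> = x0 + \<tau> * cx" for \<tau>
  define Y where "Y \<tau> = y0 + \<tau> * cy" for \<tau>
  define L where "L \<tau> = l0 + \<tau> * cl" for \<tau>
  define K where "K \<tau> = \<tau> * D" for \<tau>
  have D0: "D \<noteq> 0" using n by (simp add: D_def)
  have base: "r + x0 *\<^sub>R u - y0 *\<^sub>R w = l0 *\<^sub>R n"
    using cramer_expansion[of u w n r] n by (simp add: D_def x0_def y0_def l0_def)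
  have dir: "cx *\<^sub>R u - cy *\<^sub>R w = cl *\<^sub>R n + D *\<^sub>R m"
    unfolding D_def cx_def cy_def cl_def by (auto simp: coordinates_3 algebra_simps)
  have on_line: "r + X \<tau> *\<^sub>R u - Y \<tau> *\<^sub>R w = L \<tau> *\<^sub>R n + K \<tau> *\<^sub>R m" for \<tau>
  proof -
    have "r + X \<tau> *\<^sub>R u - Y \<tau> *\<^sub>R w = (r + x0 *\<^sub>R u - y0 *\<^sub>R w) + \<tau> *\<^sub>R (cx *\<^sub>R u - cy *\<^sub>R w)"
      by (simp add: X_def Y_def algebra_simps)
    also have "\<dots> = L \<tau> *\<^sub>R n + K \<tau> *\<^sub>R m"
      unfolding base dir by (simp add: L_def K_def algebra_simps)
    finally show ?thesis .
  qed
  have complete: "\<exists>\<tau>. x = X \<tau> \<and> y = Y \<tau> \<and> l = L \<tau> \<and> k = K \<tau>"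
    if "r + x *\<^sub>R u - y *\<^sub>R w = l *\<^sub>R n + k *\<^sub>R m" for x y l k
  proof -
    define \<tau> where "\<tau> = k / D"
    have k: "k = K \<tau>" using D0 by (simp add: \<tau>_def K_def)
    define a where "a = x - X \<tau>"
    define b where "b = y - Y \<tau>"
    define e where "e = l - L \<tau>"
    have eq: "a *\<^sub>R u - b *\<^sub>R w = e *\<^sub>R n"
    proof -
      have "a *\<^sub>R u - b *\<^sub>R w = (r + x *\<^sub>R u - y *\<^sub>R w) - (r + X \<tau> *\<^sub>R u - Y \<tau> *\<^sub>R w)"
        by (simp add: a_def b_def algebra_simps)
      also have "\<dots> = e *\<^sub>R n"
        unfolding that on_line by (simp add: k e_def algebra_simps)
      finally show ?thesis .
    qed
    have "triple (a *\<^sub>R u - b *\<^sub>R w) w n = a * D" "triple (a *\<^sub>R u - b *\<^sub>R w) u n = b * D"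
       "triple (e *\<^sub>R n) w n = 0" "triple (e *\<^sub>R n) u n = 0"
       "triple (e *\<^sub>R n) u w = e * D" "triple (a *\<^sub>R u - b *\<^sub>R w) u w = 0"
      unfolding D_def by (simp_all add: coordinates_3 algebra_simps)
    then have "a = 0" "b = 0" "e = 0" using D0 eq by auto
    then show ?thesis using k by (auto simp: a_def b_def e_def)
  qed
  have sol: "(\<exists>x y l k. r + x *\<^sub>R u - y *\<^sub>R w = l *\<^sub>R n + k *\<^sub>R m \<and> Q x y l k) \<longleftrightarrow> (\<exists>\<tau>. Q (X \<tau>) (Y \<tau>) (L \<tau>) (K \<tau>))"
    for Q :: "real \<Rightarrow> real \<Rightarrow> real \<Rightarrow> real \<Rightarrow> bool"
    using complete on_line by metis
  have edge: "edge_hits n m r (-w) \<longleftrightarrow> (\<exists>\<tau>. X \<tau> = 0 \<and> 0 < 1 - X \<tau> \<and> 0 < Y \<tau> \<and> 0 < 1 - Y \<tau> \<and> 0 < L \<tau> \<and> 0 < K \<tau>)"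
    "edge_hits n m (r+u) (-w) \<longleftrightarrow> (\<exists>\<tau>. 1 - X \<tau> = 0 \<and> 0 < X \<tau> \<and> 0 < Y \<tau> \<and> 0 < 1 - Y \<tau> \<and> 0 < L \<tau> \<and> 0 < K \<tau>)"
    "edge_hits n m r u \<longleftrightarrow> (\<exists>\<tau>. Y \<tau> = 0 \<and> 0 < X \<tau> \<and> 0 < 1 - X \<tau> \<and> 0 < 1 - Y \<tau> \<and> 0 < L \<tau> \<and> 0 < K \<tau>)"
    "edge_hits n m (r-w) u \<longleftrightarrow> (\<exists>\<tau>. 1 - Y \<tau> = 0 \<and> 0 < X \<tau> \<and> 0 < 1 - X \<tau> \<and> 0 < Y \<tau> \<and> 0 < L \<tau> \<and> 0 < K \<tau>)"
    "(\<exists>x y l. 0 < x \<and> x < 1 \<and> 0 < y \<and> y < 1 \<and> 0 < l \<and> r + x *\<^sub>R u - y *\<^sub>R w = l *\<^sub>R n) \<longleftrightarrow>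
       (\<exists>\<tau>. K \<tau> = 0 \<and> 0 < X \<tau> \<and> 0 < 1 - X \<tau> \<and> 0 < Y \<tau> \<and> 0 < 1 - Y \<tau> \<and> 0 < L \<tau>)"
    "(\<exists>x y l. 0 < x \<and> x < 1 \<and> 0 < y \<and> y < 1 \<and> 0 < l \<and> r + x *\<^sub>R u - y *\<^sub>R w = l *\<^sub>R m) \<longleftrightarrow>
       (\<exists>\<tau>. L \<tau> = 0 \<and> 0 < X \<tau> \<and> 0 < 1 - X \<tau> \<and> 0 < Y \<tau> \<and> 0 < 1 - Y \<tau> \<and> 0 < K \<tau>)"
    unfolding sol[of "\<lambda>x y l k. x = 0 \<and> 0 < 1 - x \<and> 0 < y \<and> 0 < 1 - y \<and> 0 < l \<and> 0 < k", symmetric]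
          sol[of "\<lambda>x y l k. 1 - x = 0 \<and> 0 < x \<and> 0 < y \<and> 0 < 1 - y \<and> 0 < l \<and> 0 < k", symmetric]
          sol[of "\<lambda>x y l k. y = 0 \<and> 0 < x \<and> 0 < 1 - x \<and> 0 < 1 - y \<and> 0 < l \<and> 0 < k", symmetric]
          sol[of "\<lambda>x y l k. 1 - y = 0 \<and> 0 < x \<and> 0 < 1 - x \<and> 0 < y \<and> 0 < l \<and> 0 < k", symmetric]
          sol[of "\<lambda>x y l k. k = 0 \<and> 0 < x \<and> 0 < 1 - x \<and> 0 < y \<and> 0 < 1 - y \<and> 0 < l", symmetric]
          sol[of "\<lambda>x y l k. l = 0 \<and> 0 < x \<and> 0 < 1 - x \<and> 0 < y \<and> 0 < 1 - y \<and> 0 < k", symmetric]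
    unfolding edge_hits_def by (auto simp: algebra_simps)
  \<comment> \<open>Each equation eliminates two of the four coordinates. The assumed determinants
    then forbid that the line meets two facets at once, which is the genericity required by
    \<open>signed_boundary_hits\<close>.\<close>
  have line_eqs:
    "triple r n m + X \<tau> * triple u n m - Y \<tau> * triple w n m = 0"
    "triple r w m + X \<tau> * triple u w m = L \<tau> * triple n w m"
    "triple r u m - Y \<tau> * triple w u m = L \<tau> * triple n u m"
    "triple r w n + X \<tau> * triple u w n = K \<tau> * triple m w n"
    "triple r u n - Y \<tau> * triple w u n = K \<tau> * triple m u n"
    "triple r u w = L \<tau> * triple n u w + K \<tau> * triple m u w" for \<tau>
    using arg_cong[OF on_line[of \<tau>], of "\<lambda>z. triple z n m"]
      arg_cong[OF on_line[of \<tau>], of "\<lambda>z. triple z w m"]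
      arg_cong[OF on_line[of \<tau>], of "\<lambda>z. triple z u m"]
      arg_cong[OF on_line[of \<tau>], of "\<lambda>z. triple z w n"]
      arg_cong[OF on_line[of \<tau>], of "\<lambda>z. triple z u n"]
      arg_cong[OF on_line[of \<tau>], of "\<lambda>z. triple z u w"]
    by (simp_all add: inner_add_left inner_diff_left dot_cross_self)
  have no_XY: "X \<tau> = a \<Longrightarrow> Y \<tau> = b \<Longrightarrow> a \<in> {0, 1} \<Longrightarrow> b \<in> {0, 1} \<Longrightarrow> False" for \<tau> a b
    using line_eqs(1)[of \<tau>] nm by (auto simp: inner_add_left inner_diff_left)
  have no_X: "X \<tau> \<in> {0, 1} \<Longrightarrow> L \<tau> \<noteq> 0 \<and> K \<tau> \<noteq> 0" for \<tau>
    using line_eqs(2,4)[of \<tau>] n m by (auto simp: inner_add_left inner_diff_left)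
  have no_Y: "Y \<tau> \<in> {0, 1} \<Longrightarrow> L \<tau> \<noteq> 0 \<and> K \<tau> \<noteq> 0" for \<tau>
    using line_eqs(3,5)[of \<tau>] n m by (auto simp: inner_add_left inner_diff_left)
  have no_LK: "L \<tau> = 0 \<Longrightarrow> K \<tau> \<noteq> 0" for \<tau>
    using line_eqs(6)[of \<tau>] d by auto
  \<comment> \<open>Facets in the order \<open>x = 0\<close>, \<open>x = 1\<close>,
    \<open>y = 0\<close>, \<open>y = 1\<close>, \<open>l = 0\<close>, \<open>k = 0\<close>. The last
    start value is 0 because \<open>\<tau>\<close> is measured from the facet
    \<open>k = 0\<close>.\<close>
  define \<alpha> where "\<alpha> = (!) [x0, 1 - x0, y0, 1 - y0, l0, 0]"
  define c where "c = (!) [cx, - cx, cy, - cy, cl, D]"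
  have less_6: "{..<6::nat} = {0, 1, 2, 3, 4, 5}" by auto
  have c_nz: "cx \<noteq> 0" "cy \<noteq> 0" "cl \<noteq> 0"
    using nm n m by (auto simp: cx_def cy_def cl_def)
  have pos_neg: "\<exists>i\<in>{..<6}. 0 < c i" "\<exists>i\<in>{..<6}. c i < 0"
    using c_nz(1) linorder_neqE_linordered_idom[of cx 0] unfolding less_6
    by (auto simp: c_def)
  have line_vals: "\<alpha> 0 + \<tau> * c 0 = X \<tau>" "\<alpha> 1 + \<tau> * c 1 = 1 - X \<tau>"
      "\<alpha> 2 + \<tau> * c 2 = Y \<tau>" "\<alpha> 3 + \<tau> * c 3 = 1 - Y \<tau>"
      "\<alpha> 4 + \<tau> * c 4 = L \<tau>" "\<alpha> 5 + \<tau> * c 5 = K \<tau>" for \<tau>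
    by (auto simp: \<alpha>_def c_def X_def Y_def L_def K_def)
  have generic: "\<alpha> j + \<tau> * c j \<noteq> 0"
    if "i \<in> {..<6}" "j \<in> {..<6}" "i \<noteq> j" "\<alpha> i + \<tau> * c i = 0" for i j \<tau>
    using that no_XY[of \<tau>] no_X[of \<tau>] no_Y[of \<tau>] no_LK[of \<tau>]
    unfolding less_6 by (elim insertE) (auto simp: line_vals simp del: One_nat_def)
  have "(\<Sum>i<6. sgn (c i) *
      of_bool (\<exists>\<tau>. \<alpha> i + \<tau> * c i = 0 \<and> (\<forall>j\<in>{..<6} - {i}. 0 < \<alpha> j + \<tau> * c j))) = 0"
    using pos_neg c_nz D0 generic
    by (intro signed_boundary_hits) (auto simp: less_6 c_def)
  moreover have "{..<6} - {0} = {1,2,3,4,5::nat}" "{..<6} - {1} = {0,2,3,4,5::nat}" "{..<6} - {2} = {0,1,3,4,5::nat}"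
    "{..<6} - {3} = {0,1,2,4,5::nat}" "{..<6} - {4} = {0,1,2,3,5::nat}" "{..<6} - {5} = {0,1,2,3,4::nat}"
    by auto
  moreover have "(\<Sum>i<6. f i) = f 0 + f 1 + f 2 + f 3 + f 4 + f (5::nat)" for f :: "nat \<Rightarrow> real"
    unfolding less_6 by simp
  moreover have c_at: "c 0 = cx" "c 1 = - cx" "c 2 = cy" "c 3 = - cy" "c 4 = cl" "c 5 = D"
    by (auto simp: c_def)
  moreover note X_Y_L_K = line_vals[unfolded c_at]
  ultimately have "sgn cx * of_bool (edge_hits n m r (-w)) + sgn (- cx) * of_bool (edge_hits n m (r+u) (-w))
     + sgn cy * of_bool (edge_hits n m r u) + sgn (- cy) * of_bool (edge_hits n m (r-w) u)
     + sgn cl * of_bool (\<exists>x y l. 0 < x \<and> x < 1 \<and> 0 < y \<and> y < 1 \<and> 0 < l \<and> r + x *\<^sub>R u - y *\<^sub>R w = l *\<^sub>R m)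
     + sgn D * of_bool (\<exists>x y l. 0 < x \<and> x < 1 \<and> 0 < y \<and> y < 1 \<and> 0 < l \<and> r + x *\<^sub>R u - y *\<^sub>R w = l *\<^sub>R n) = 0"
    by (simp only: edge X_Y_L_K simp_thms ball_simps)
  then show ?thesis
    by (simp add: cx_def cy_def cl_def D_def sgn_minus algebra_simps)
qed


section \<open>Telescoping of signed hits between transversal directions\<close>

definition signed_hit :: "real^3 \<Rightarrow> (real^3) \<times> (real^3) \<Rightarrow> (real^3) \<times> (real^3) \<Rightarrow> real" where
  "signed_hit n s t = (if hits n s t then sgn (side_det s t) else 0)"

text \<open>Seen along \<open>n\<close>, no endpoint of one side lies on the line of the other, and
  the two sides are not parallel.\<close>

definition transversal :: "real^3 \<Rightarrow> (real^3) \<times> (real^3) \<Rightarrow> (real^3) \<times> (real^3) \<Rightarrow> bool" where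
  "transversal n s t \<longleftrightarrow>
     (let r = fst s - fst t; u = snd s - fst s; w = snd t - fst t in
      n \<bullet> cross3 r w \<noteq> 0 \<and> n \<bullet> cross3 (r + u) w \<noteq> 0 \<and> n \<bullet> cross3 r u \<noteq> 0 \<and>
      n \<bullet> cross3 (r - w) u \<noteq> 0 \<and> n \<bullet> cross3 u w \<noteq> 0)"

text \<open>The six vectors are the differences of the four endpoints, so no line through two of
  them is parallel to the plane of \<open>n\<close> and \<open>m\<close>.\<close>

definition transversal_pair ::
    "real^3 \<Rightarrow> real^3 \<Rightarrow> (real^3) \<times> (real^3) \<Rightarrow> (real^3) \<times> (real^3) \<Rightarrow> bool" where
  "transversal_pair n m s t \<longleftrightarrow>
     (let r = fst s - fst t; u = snd s - fst s; w = snd t - fst t in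
      \<forall>v\<in>{r, r + u, r - w, r + u - w, u, w}. m \<bullet> cross3 v n \<noteq> 0)"

lemma triple_rotate: "triple x y z = triple z x y"
  by (simp add: coordinates_3 algebra_simps)

text \<open>Pairing the equation of the hit with the cross product of the two sides leaves the
  factor \<open>l\<close>, which is positive.\<close>

lemma hits_sgn:
  assumes "hits n s t"
  shows "sgn (triple (snd s - fst s) (snd t - fst t) n) = sgn (side_det s t)"
proof -
  obtain x y l where l: "0 < l" and
    eq: "(fst s - fst t) + x *\<^sub>R (snd s - fst s) - y *\<^sub>R (snd t - fst t) = l *\<^sub>R n"
    using assms by (auto simp: hits_def)
  have "side_det s t = l * triple n (snd s - fst s) (snd t - fst t)"
    using arg_cong[OF eq, of "\<lambda>z. triple z (snd s - fst s) (snd t - fst t)"]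
    by (simp add: side_det_def inner_add_left inner_diff_left dot_cross_self)
  then show ?thesis using l triple_rotate[of "snd s - fst s" "snd t - fst t" n] by (simp add: sgn_mult)
qed

definition vertex_side_term :: "real^3 \<Rightarrow> real^3 \<Rightarrow> real^3 \<Rightarrow> (real^3) \<times> (real^3) \<Rightarrow> real" where
  "vertex_side_term n m p t = sgn (triple (snd t - fst t) n m) *
     of_bool (edge_hits n m (p - fst t) (- (snd t - fst t)))"

definition side_vertex_term :: "real^3 \<Rightarrow> real^3 \<Rightarrow> (real^3) \<times> (real^3) \<Rightarrow> real^3 \<Rightarrow> real" where
  "side_vertex_term n m s q = sgn (triple (snd s - fst s) n m) *
     of_bool (edge_hits n m (fst s - q) (snd s - fst s))"

text \<open>This is \<open>quad_boundary\<close>, arranged as a difference over the ends of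
  \<open>s\<close> plus a difference over the ends of \<open>t\<close>: the form that telescopes
  along closed polygons.\<close>

lemma signed_hit_diff:
  assumes d: "side_det s t \<noteq> 0" and n: "transversal n s t" and m: "transversal m s t"
    and nm: "transversal_pair n m s t"
  shows "signed_hit m s t - signed_hit n s t =
    (vertex_side_term n m (fst s) t - vertex_side_term n m (snd s) t) +
    (side_vertex_term n m s (fst t) - side_vertex_term n m s (snd t))"
proof -
  define r where "r = fst s - fst t"
  define u where "u = snd s - fst s"
  define w where "w = snd t - fst t"
  have hit: "signed_hit k s t = sgn (triple u w k) * of_bool (hits k s t)" for k
    using hits_sgn[of k s t] by (auto simp: signed_hit_def u_def w_def)
  have corners: "snd s - fst t = r + u" "fst s - snd t = r - w"
    by (auto simp: r_def u_def w_def)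
  note fold = r_def[symmetric] u_def[symmetric] w_def[symmetric]
  have dets: "triple r u w \<noteq> 0"
    "triple r w n \<noteq> 0" "triple (r+u) w n \<noteq> 0" "triple r u n \<noteq> 0" "triple (r-w) u n \<noteq> 0" "triple u w n \<noteq> 0"
    "triple r w m \<noteq> 0" "triple (r+u) w m \<noteq> 0" "triple r u m \<noteq> 0" "triple (r-w) u m \<noteq> 0" "triple u w m \<noteq> 0"
    "triple r n m \<noteq> 0" "triple (r+u) n m \<noteq> 0" "triple (r-w) n m \<noteq> 0" "triple (r+u-w) n m \<noteq> 0"
    "triple u n m \<noteq> 0" "triple w n m \<noteq> 0"
    using d n m nm unfolding side_det_def transversal_def transversal_pair_def Let_def fold
    by (auto simp: triple_rotate[of _ _ n] triple_rotate[of _ _ m])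
  have rearrange: "e - f = (a * b - a * b') + (c * d - c * d')" if "a * (b - b') + c * (d - d') + f = e"
    for a b b' c d d' e f :: real
    using that by (simp add: algebra_simps)
  show ?thesis
    unfolding hit vertex_side_term_def side_vertex_term_def corners hits_def fold
    by (rule rearrange[OF quad_boundary[OF dets]])
qed

text \<open>Every vertex of a closed polygon starts one side and ends one side.\<close>

lemma sum_sides_telescope:
  fixes f :: "real^3 \<Rightarrow> real"
  assumes "distinct L"
  shows "(\<Sum>s\<in>sides L. f (fst s) - f (snd s)) = 0"
proof -
  have "(\<Sum>s\<in>sides L. f (fst s) - f (snd s)) = (\<Sum>s\<leftarrow>zip L (rotate1 L). f (fst s) - f (snd s))"
    unfolding sides_def using assms by (intro sum.distinct_set_conv_list distinct_zipI1)
  also have "\<dots> = sum_list (map (f \<circ> fst) (zip L (rotate1 L))) - sum_list (map (f \<circ> snd) (zip L (rotate1 L)))"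
    by (simp add: sum_list_subtractf o_def)
  also have "\<dots> = sum_list (map f L) - sum_list (map f (rotate1 L))"
    by (simp flip: map_map)
  also have "\<dots> = 0"
    by (cases L) simp_all
  finally show ?thesis .
qed

lemma sum_signed_hit_transversal:
  assumes "distinct L1" "distinct L2"
    and "\<And>s t. s \<in> sides L1 \<Longrightarrow> t \<in> sides L2 \<Longrightarrow> side_det s t \<noteq> 0 \<and>
       transversal n s t \<and> transversal m s t \<and> transversal_pair n m s t"
  shows "(\<Sum>s\<in>sides L1. \<Sum>t\<in>sides L2. signed_hit m s t) = (\<Sum>s\<in>sides L1. \<Sum>t\<in>sides L2. signed_hit n s t)"
proof -
  have "(\<Sum>s\<in>sides L1. \<Sum>t\<in>sides L2. signed_hit m s t) - (\<Sum>s\<in>sides L1. \<Sum>t\<in>sides L2. signed_hit n s t)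
    = (\<Sum>s\<in>sides L1. \<Sum>t\<in>sides L2. (vertex_side_term n m (fst s) t - vertex_side_term n m (snd s) t) +
    (side_vertex_term n m s (fst t) - side_vertex_term n m s (snd t)))"
    unfolding sum_subtractf[symmetric] using assms by (intro sum.cong refl signed_hit_diff) auto
  also have "\<dots> = (\<Sum>t\<in>sides L2. \<Sum>s\<in>sides L1. vertex_side_term n m (fst s) t - vertex_side_term n m (snd s) t)
     + (\<Sum>s\<in>sides L1. \<Sum>t\<in>sides L2. side_vertex_term n m s (fst t) - side_vertex_term n m s (snd t))"
    by (subst sum.swap) (simp add: sum.distrib)
  also have "\<dots> = 0"
    using assms(1,2) by (simp add: sum_sides_telescope[of L1 "\<lambda>p. vertex_side_term n m p _"] sum_sides_telescope)
  finally show ?thesis by simp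
qed

text \<open>Cramer's rule gives \<open>x\<close>, \<open>y\<close>, \<open>l\<close> as quotients
  with denominator \<open>triple u w n\<close>. Multiplying the bounds on \<open>x\<close> and
  \<open>y\<close> by \<open>d * triple u w n\<close>, which is positive at a hit, turns them into
  strict inequalities linear in \<open>n\<close>. The first two add up to
  \<open>0 < d * triple u w n\<close>, so \<open>0 < l\<close> is included.\<close>

lemma hits_iff_det:
  fixes s t :: "(real^3) \<times> (real^3)"
  defines "r \<equiv> fst s - fst t" and "u \<equiv> snd s - fst s" and "w \<equiv> snd t - fst t"
  defines "d \<equiv> side_det s t"
  assumes "d \<noteq> 0"
  shows "hits n s t \<longleftrightarrow> 0 < - d * triple r w n \<and> 0 < d * (triple u w n + triple r w n) \<and>
    0 < - d * triple r u n \<and> 0 < d * (triple u w n + triple r u n)"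
proof
  assume "hits n s t"
  then obtain x y l where xy: "0 < x" "x < 1" "0 < y" "y < 1" "0 < l" and
    eq: "r + x *\<^sub>R u - y *\<^sub>R w = l *\<^sub>R n"
    by (auto simp: hits_def r_def u_def w_def)
  have d: "d = l * triple u w n"
    using arg_cong[OF eq, of "\<lambda>z. triple z u w"] triple_rotate[of u w n]
    by (simp add: d_def side_det_def r_def[symmetric] u_def[symmetric] w_def[symmetric]
        inner_add_left inner_diff_left dot_cross_self)
  have x: "triple r w n = - (x * triple u w n)"
    using arg_cong[OF eq, of "\<lambda>z. triple z w n"]
    by (simp add: inner_add_left inner_diff_left dot_cross_self)
  have "triple r u n = - (y * triple u w n)"
    using arg_cong[OF eq, of "\<lambda>z. triple z u n"]
    by (simp add: inner_add_left inner_diff_left dot_cross_self) (simp add: coordinates_3 algebra_simps)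
  moreover have pos: "0 < d * triple u w n"
  proof -
    have "d * triple u w n = l * (triple u w n)\<^sup>2" unfolding d by (simp add: power2_eq_square)
    moreover have "0 < (triple u w n)\<^sup>2" using d \<open>d \<noteq> 0\<close> by auto
    ultimately show ?thesis using xy(5) by (simp only: mult_pos_pos)
  qed
  ultimately have multiples: "- d * triple r w n = x * (d * triple u w n)"
    "d * (triple u w n + triple r w n) = (1 - x) * (d * triple u w n)"
    "- d * triple r u n = y * (d * triple u w n)"
    "d * (triple u w n + triple r u n) = (1 - y) * (d * triple u w n)"
    using x by (simp_all add: algebra_simps)
  then show "0 < - d * triple r w n \<and> 0 < d * (triple u w n + triple r w n) \<and>
    0 < - d * triple r u n \<and> 0 < d * (triple u w n + triple r u n)"
    unfolding multiples using pos xy by simp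
next
  assume "0 < - d * triple r w n \<and> 0 < d * (triple u w n + triple r w n) \<and>
    0 < - d * triple r u n \<and> 0 < d * (triple u w n + triple r u n)"
  then have pos: "0 < - d * triple r w n" "0 < d * (triple u w n + triple r w n)"
    "0 < - d * triple r u n" "0 < d * (triple u w n + triple r u n)"
    by auto
  define D where "D = triple u w n"
  have dD: "0 < d * D" using pos(1,2) by (simp add: D_def algebra_simps)
  then have "D \<noteq> 0" by auto
  have *: "0 < a / D \<and> a / D < 1" if "0 < d * a" "0 < d * (D - a)" for a
  proof -
    have "0 < (d * a) / (d * D)" using that(1) dD by (rule divide_pos_pos)
    moreover have "(d * a) / (d * D) < 1"
      using that(2) dD by (simp only: divide_less_eq_1_pos right_diff_distrib diff_gt_0_iff_gt)
    ultimately show ?thesis using \<open>d \<noteq> 0\<close> by simp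
  qed
  have "0 < d / D" using dD by (auto simp: zero_less_mult_iff zero_less_divide_iff)
  moreover have "r + (- triple r w n / D) *\<^sub>R u - (- triple r u n / D) *\<^sub>R w = (d / D) *\<^sub>R n"
    using cramer_expansion[of u w n r] \<open>D \<noteq> 0\<close>
    by (simp add: D_def d_def side_det_def r_def[symmetric] u_def[symmetric] w_def[symmetric])
  ultimately show "hits n s t"
    unfolding hits_def r_def[symmetric] u_def[symmetric] w_def[symmetric]
    using *[of "- triple r w n"] *[of "- triple r u n"] pos unfolding D_def[symmetric]
    by (smt (verit, ccfv_threshold) mult_minus_left mult_minus_right)
qed


text \<open>The weaker genericity that a generic projection supplies. In contrast to
  \<open>transversal\<close>, an endpoint may be seen on the prolongation of the other side. The
  factor \<open>l\<close> has any sign, so it does not matter which point is on top.\<close>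

definition boundary_free :: "real^3 \<Rightarrow> (real^3) \<times> (real^3) \<Rightarrow> (real^3) \<times> (real^3) \<Rightarrow> bool" where
  "boundary_free n s t \<longleftrightarrow> (\<forall>x y l. x \<in> {0..1} \<and> y \<in> {0..1} \<and> (x \<in> {0, 1} \<or> y \<in> {0, 1}) \<longrightarrow>
     (fst s - fst t) + x *\<^sub>R (snd s - fst s) - y *\<^sub>R (snd t - fst t) \<noteq> l *\<^sub>R n)"

text \<open>By \<open>hits_iff_det\<close> a hit consists of four strict inequalities, which persist
  nearby. A miss persists as well, because one of the four fails strictly.\<close>

lemma signed_hit_locally_constant:
  assumes d: "side_det s t \<noteq> 0" and "n \<noteq> 0" and free: "boundary_free n s t"
  shows "\<forall>\<^sub>F k in nhds n. signed_hit k s t = signed_hit n s t"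
proof -
  define r where "r = fst s - fst t"
  define u where "u = snd s - fst s"
  define w where "w = snd t - fst t"
  define d where "d = side_det s t"
  note fold = r_def[symmetric] u_def[symmetric] w_def[symmetric] d_def[symmetric]
  have d0: "d \<noteq> 0" using assms by (simp add: d_def)
  define f where "f k = (\<lambda>i. [- d * triple r w k, d * (triple u w k + triple r w k),
      - d * triple r u k, d * (triple u w k + triple r u k)] ! i)" for k
  have hit: "hits k s t \<longleftrightarrow> (\<forall>i\<in>{0,1,2,3}. 0 < f k i)" for k
    using hits_iff_det[OF assms(1)] unfolding fold by (simp add: f_def)
  have lim: "((\<lambda>k. f k i) \<longlongrightarrow> f n i) (nhds n)" if "i \<in> {0,1,2,3}" for i
    using that unfolding f_def triple_rotate[of _ _ "_ :: real^3"]
    by (auto intro!: tendsto_intros filterlim_ident simp: coordinates_3)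
  \<comment> \<open>If all four values were nonnegative and one were zero, then \<open>x\<close> and
    \<open>y\<close> from Cramer's rule would lie in the closed unit square, on its boundary. If the
    denominator \<open>D\<close> vanishes, the linear relation degenerates to
    \<open>d *\<^sub>R n = 0\<close> instead.\<close>
  have neg: "\<exists>i\<in>{0,1,2,3}. f n i < 0" if "\<not> hits n s t"
  proof (rule ccontr)
    define D where "D = triple u w n"
    assume "\<not> (\<exists>i\<in>{0,1,2,3}. f n i < 0)"
    then have nonneg: "0 \<le> d * (- triple r w n)" "0 \<le> d * (D - (- triple r w n))"
      "0 \<le> d * (- triple r u n)" "0 \<le> d * (D - (- triple r u n))"
      by (auto simp: f_def D_def)
    have zero: "d * (- triple r w n) = 0 \<or> d * (D - (- triple r w n)) = 0 \<or>
       d * (- triple r u n) = 0 \<or> d * (D - (- triple r u n)) = 0"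
      using that nonneg unfolding hit by (auto simp: f_def D_def)
    show False
    proof (cases "D = 0")
      case True
      then have "d * triple r w n = 0" "d * triple r u n = 0"
        using nonneg by simp_all
      then have "triple r w n = 0" "triple r u n = 0"
        using d0 by simp_all
      then have "d *\<^sub>R n = 0"
        using cramer_numerators[of u w n r] True by (simp add: D_def d_def side_det_def fold)
      then show False using d0 \<open>n \<noteq> 0\<close> by simp
    next
      case False
      have "0 \<le> d * D" using nonneg(1,2) by (simp add: algebra_simps)
      then have dD: "0 < d * D" using False d0 by (simp add: less_le)
      have *: "a / D \<in> {0..1}" if "0 \<le> d * a" "0 \<le> d * (D - a)" for a
      proof -
        have "0 \<le> (d * a) / (d * D)" using that(1) dD by (rule divide_nonneg_pos)
        moreover have "(d * a) / (d * D) \<le> 1"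
          using that(2) dD by (simp only: divide_le_eq_1_pos right_diff_distrib diff_ge_0_iff_ge)
        ultimately show ?thesis using d0 by simp
      qed
      have "triple r w n \<in> {0, - D} \<or> triple r u n \<in> {0, - D}"
        using zero d0 by (auto simp: add_eq_0_iff)
      then have "- triple r w n / D \<in> {0, 1} \<or> - triple r u n / D \<in> {0, 1}"
        using False by auto
      then show False
        using free cramer_expansion[of u w n r] False * nonneg
        unfolding boundary_free_def fold D_def[symmetric] by blast
    qed
  qed
  show ?thesis
  proof (cases "hits n s t")
    case True
    then have "\<forall>i\<in>{0,1,2,3}. \<forall>\<^sub>F k in nhds n. 0 < f k i"
      using lim order_tendstoD(1) unfolding hit by blast
    then have "\<forall>\<^sub>F k in nhds n. hits k s t"
      unfolding hit by (simp add: eventually_conj_iff)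
    then show ?thesis by (rule eventually_mono) (use True in \<open>simp add: signed_hit_def\<close>)
  next
    case False
    then obtain i where i: "i \<in> {0,1,2,3}" "f n i < 0" using neg by auto
    then have "\<forall>\<^sub>F k in nhds n. f k i < 0" using lim order_tendstoD(2) by blast
    then have "\<forall>\<^sub>F k in nhds n. \<not> hits k s t"
      unfolding hit by (rule eventually_mono) (use i in force)
    then show ?thesis by (rule eventually_mono) (use False in \<open>simp add: signed_hit_def\<close>)
  qed
qed

text \<open>A nonempty open set is not negligible and is therefore not covered by finitely many
  planes.\<close>

lemma generic_direction_nearby:
  fixes n :: "real^3"
  assumes "\<forall>\<^sub>F k in nhds n. P k" and "finite W" and "0 \<notin> W"
  shows "\<exists>k. P k \<and> (\<forall>v\<in>W. k \<bullet> v \<noteq> 0)"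
proof -
  obtain U where U: "open U" "n \<in> U" "\<And>k. k \<in> U \<Longrightarrow> P k"
    using assms(1) by (auto simp: eventually_nhds)
  have "negligible (\<Union>v\<in>W. {k. v \<bullet> k = 0})"
    using assms by (intro negligible_Union) (auto intro!: negligible_hyperplane)
  then have "\<not> U \<subseteq> (\<Union>v\<in>W. {k. v \<bullet> k = 0})"
    using open_not_negligible[OF U(1)] negligible_subset U(2) by blast
  then show ?thesis using U(3) by (auto simp: inner_commute)
qed

text \<open>Both directions are perturbed, without changing any signed hit, until the telescoping
  argument applies.\<close>

lemma sum_signed_hit_independent:
  assumes "distinct L1" "distinct L2" "n \<noteq> 0" "m \<noteq> 0"
    and st: "\<And>s t. s \<in> sides L1 \<Longrightarrow> t \<in> sides L2 \<Longrightarrow> side_det s t \<noteq> 0 \<and> boundary_free n s t \<and> boundary_free m s t"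
  shows "(\<Sum>s\<in>sides L1. \<Sum>t\<in>sides L2. signed_hit m s t) = (\<Sum>s\<in>sides L1. \<Sum>t\<in>sides L2. signed_hit n s t)"
proof -
  define S where "S = sides L1 \<times> sides L2"
  have fin: "finite S" by (simp add: S_def sides_def)
  define normals where "normals s t = (let r = fst s - fst t; u = snd s - fst s; w = snd t - fst t in
      {cross3 r w, cross3 (r + u) w, cross3 r u, cross3 (r - w) u, cross3 u w})" for s t :: "(real^3) \<times> (real^3)"
  define W1 where "W1 = (\<Union>(s, t)\<in>S. normals s t)"
  have normals_nz: "0 \<notin> normals s t" if "(s, t) \<in> S" for s t
  proof
    assume "0 \<in> normals s t"
    moreover have "triple r u w = 0"
      if "cross3 r w = 0 \<or> cross3 (r + u) w = 0 \<or> cross3 r u = 0 \<or> cross3 (r - w) u = 0 \<or> cross3 u w = 0"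
      for r u w :: "real^3"
    proof -
      have "triple r u w = - (u \<bullet> cross3 r w)" "triple r u w = - (u \<bullet> cross3 (r + u) w)"
        "triple r u w = w \<bullet> cross3 r u" "triple r u w = w \<bullet> cross3 (r - w) u"
        by (simp_all add: coordinates_3 algebra_simps)
      then show ?thesis using that by (elim disjE) simp_all
    qed
    ultimately have "side_det s t = 0"
      unfolding normals_def side_det_def Let_def by (simp add: eq_commute[of 0])
    then show False using st that by (auto simp: S_def)
  qed
  have trans_iff: "transversal k s t \<longleftrightarrow> (\<forall>v\<in>normals s t. k \<bullet> v \<noteq> 0)" for k s t
    by (auto simp: transversal_def normals_def Let_def)
  have W1: "finite W1" "0 \<notin> W1"
    using fin normals_nz by (auto simp: W1_def normals_def Let_def)
  have ev: "\<forall>\<^sub>F k in nhds i. \<forall>(s, t)\<in>S. signed_hit k s t = signed_hit i s t" if "i \<in> {n, m}" for i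
    using st that assms(3,4) fin
    by (intro eventually_ball_finite) (auto simp: S_def intro!: signed_hit_locally_constant)
  \<comment> \<open>The direction \<open>n'\<close> is fixed before \<open>m'\<close>, because the
    conditions on the pair, collected in \<open>W2\<close>, depend on \<open>n'\<close>.\<close>
  obtain n' where n': "\<forall>(s, t)\<in>S. signed_hit n' s t = signed_hit n s t" "\<forall>v\<in>W1. n' \<bullet> v \<noteq> 0"
    using generic_direction_nearby[OF ev[of n] W1] by auto
  define vs where "vs s t = (let r = fst s - fst t; u = snd s - fst s; w = snd t - fst t in
      {r, r + u, r - w, r + u - w, u, w})" for s t :: "(real^3) \<times> (real^3)"
  define W2 where "W2 = (\<Union>(s, t)\<in>S. (\<lambda>v. cross3 v n') ` vs s t)"
  have W2: "finite W2" "0 \<notin> W2"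
  proof -
    show "finite W2" using fin by (auto simp: W2_def vs_def Let_def)
    show "0 \<notin> W2"
    proof
      assume "0 \<in> W2"
      then obtain s t v where v: "(s, t) \<in> S" "v \<in> vs s t" "cross3 v n' = 0" by (auto simp: W2_def)
      then have N: "\<forall>q\<in>normals s t. n' \<bullet> q \<noteq> 0" using n' by (auto simp: W1_def)
      \<comment> \<open>If \<open>cross3 v n'\<close> vanishes, \<open>n'\<close> is orthogonal to
        every cross product with factor \<open>v\<close>, against its transversality. The difference
        \<open>snd s - snd t\<close> is not a factor of the listed normals, but subtracting
        \<open>w\<close> from the first factor of \<open>cross3 (r + u) w\<close> produces
        it.\<close>
      have "n' \<bullet> cross3 v q = 0" "n' \<bullet> cross3 q v = 0" for q
        using v(3) by (metis cross_triple inner_commute inner_zero_right cross_skew neg_equal_0_iff_equal)+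
      moreover have "cross3 (snd s - fst t) (snd t - fst t) = cross3 (snd s - snd t) (snd t - fst t)"
        by (simp add: coordinates_3 algebra_simps)
      then have "n' \<bullet> cross3 (snd s - snd t) (snd t - fst t) \<noteq> 0"
        using N by (simp add: normals_def Let_def)
      ultimately show False using v(2) N
        unfolding normals_def vs_def Let_def
        by (elim insertE) auto
    qed
  qed
  obtain m' where m': "\<forall>(s, t)\<in>S. signed_hit m' s t = signed_hit m s t" "\<forall>v\<in>W1 \<union> W2. m' \<bullet> v \<noteq> 0"
    using generic_direction_nearby[OF ev[of m], of "W1 \<union> W2"] W1 W2 by auto
  have "(\<Sum>s\<in>sides L1. \<Sum>t\<in>sides L2. signed_hit m s t) = (\<Sum>s\<in>sides L1. \<Sum>t\<in>sides L2. signed_hit m' s t)"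
    using m' by (intro sum.cong) (auto simp: S_def)
  also have "\<dots> = (\<Sum>s\<in>sides L1. \<Sum>t\<in>sides L2. signed_hit n' s t)"
  proof (rule sum_signed_hit_transversal)
    fix s t assume *: "s \<in> sides L1" "t \<in> sides L2"
    then have "(s, t) \<in> S" by (simp add: S_def)
    then have "\<forall>v\<in>vs s t. m' \<bullet> cross3 v n' \<noteq> 0" "\<forall>v\<in>normals s t. m' \<bullet> v \<noteq> 0" "\<forall>v\<in>normals s t. n' \<bullet> v \<noteq> 0"
      using m'(2) n'(2) by (fastforce simp: W1_def W2_def)+
    then show "side_det s t \<noteq> 0 \<and> transversal n' s t \<and> transversal m' s t \<and> transversal_pair n' m' s t"
      using st[OF *] by (simp add: trans_iff transversal_pair_def vs_def)
  qed (use assms in auto)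
  also have "\<dots> = (\<Sum>s\<in>sides L1. \<Sum>t\<in>sides L2. signed_hit n s t)"
    using n' by (intro sum.cong) (auto simp: S_def)
  finally show ?thesis .
qed


section \<open>From projections to viewing directions\<close>

lemma orthonormal_frame_expansion:
  assumes F: "orthonormal_frame F" and z: "z \<bullet> fst F = 0" "z \<bullet> snd F = 0"
  defines "n \<equiv> cross3 (fst F) (snd F)"
  shows "z = (z \<bullet> n) *\<^sub>R n" "n \<bullet> n = 1"
proof -
  have *: "fst F \<bullet> fst F = 1" "snd F \<bullet> snd F = 1" "fst F \<bullet> snd F = 0"
    using F by (auto simp: orthonormal_frame_def norm_eq_1)
  show nn: "n \<bullet> n = 1"
    unfolding n_def dot_cross using * by (simp add: inner_commute)
  have "cross3 n (cross3 z n) = (n \<bullet> n) *\<^sub>R z - (n \<bullet> z) *\<^sub>R n"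
    by (rule Lagrange)
  moreover have "cross3 z n = 0"
    unfolding n_def Lagrange using z by simp
  ultimately show "z = (z \<bullet> n) *\<^sub>R n" using nn by (simp add: inner_commute)
qed

lemma proj_eq_iff:
  assumes F: "orthonormal_frame F"
  defines "n \<equiv> cross3 (fst F) (snd F)"
  shows "proj F x = proj F y \<longleftrightarrow> (\<exists>l. x - y = l *\<^sub>R n)"
proof
  assume "proj F x = proj F y"
  then have "(x - y) \<bullet> fst F = 0" "(x - y) \<bullet> snd F = 0"
    by (auto simp: proj_def inner_diff_left)
  then show "\<exists>l. x - y = l *\<^sub>R n"
    using orthonormal_frame_expansion(1)[OF F, of "x - y"] unfolding n_def by blast
next
  assume "\<exists>l. x - y = l *\<^sub>R n"
  then obtain l where l: "x - y = l *\<^sub>R n" by blast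
  have "(x - y) \<bullet> fst F = 0" "(x - y) \<bullet> snd F = 0"
    unfolding l n_def by (simp_all add: dot_cross_self)
  then show "proj F x = proj F y" by (simp add: proj_def inner_diff_left)
qed

lemma passes_over_iff_hits:
  assumes F: "orthonormal_frame F" and d: "side_det s t \<noteq> 0"
  shows "passes_over F s t \<longleftrightarrow> hits (cross3 (fst F) (snd F)) s t"
proof -
  define n where "n = cross3 (fst F) (snd F)"
  have nn: "n \<bullet> n = 1"
    using orthonormal_frame_expansion(2)[OF F, of 0] by (simp add: n_def)
  have ne: "fst s \<noteq> snd s" "fst t \<noteq> snd t"
    using d by (auto simp: side_det_def)
  have over: "proj F x = proj F y \<and> height F y < height F x \<longleftrightarrow> (\<exists>l>0. x - y = l *\<^sub>R n)" for x y
  proof -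
    have "height F x - height F y = l" if "x - y = l *\<^sub>R n" for l
      using arg_cong[OF that, of "\<lambda>z. z \<bullet> n"] nn by (simp add: height_def n_def inner_diff_left)
    then show ?thesis unfolding proj_eq_iff[OF F] n_def[symmetric]
      by (metis diff_gt_0_iff_gt)
  qed
  have seg: "x \<in> open_segment a b \<longleftrightarrow> (\<exists>k. 0 < k \<and> k < 1 \<and> x = a + k *\<^sub>R (b - a))" if "a \<noteq> b" for x a b :: "real^3"
    using that by (auto simp: in_segment algebra_simps)
  have "passes_over F s t \<longleftrightarrow> (\<exists>j k. 0 < j \<and> j < 1 \<and> 0 < k \<and> k < 1 \<and>
      (\<exists>l>0. (fst s + j *\<^sub>R (snd s - fst s)) - (fst t + k *\<^sub>R (snd t - fst t)) = l *\<^sub>R n))"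
    unfolding passes_over_def over Bex_def seg[OF ne(1)] seg[OF ne(2)] by blast
  also have "\<dots> \<longleftrightarrow> hits n s t"
    unfolding hits_def by (simp add: algebra_simps)
  finally show ?thesis by (simp add: n_def)
qed

text \<open>The definition of the sign looks at the start of \<open>t\<close> only. At a crossing
  that point lies on the side of the line of \<open>s\<close> from which \<open>t\<close> comes, so
  \<open>triple u r n\<close> is a positive multiple of \<open>triple u w n\<close>.\<close>

lemma crossing_sign_eq:
  assumes F: "orthonormal_frame F" and h: "hits (cross3 (fst F) (snd F)) s t" and d: "side_det s t \<noteq> 0"
  shows "real_of_int (crossing_sign F s t) = sgn (side_det s t)"
proof -
  define n where "n = cross3 (fst F) (snd F)"
  define r where "r = fst s - fst t"
  define u where "u = snd s - fst s"
  define w where "w = snd t - fst t"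
  obtain x y l where y: "0 < y" and eq: "r + x *\<^sub>R u - y *\<^sub>R w = l *\<^sub>R n"
    using h by (auto simp: hits_def r_def u_def w_def n_def)
  have "triple u r n = y * triple u w n"
    using arg_cong[OF eq, of "\<lambda>z. triple z u n"]
    by (simp add: inner_add_left inner_diff_left dot_cross_self) (simp add: coordinates_3 algebra_simps)
  moreover have "(u \<bullet> fst F) * ((- r) \<bullet> snd F) - (u \<bullet> snd F) * ((- r) \<bullet> fst F) = - triple u r n"
    unfolding n_def by (simp add: coordinates_3 algebra_simps)
  ultimately have "clockwise (proj F (fst s)) (proj F (snd s)) (proj F (fst t)) \<longleftrightarrow> 0 < triple u w n"
    using y unfolding clockwise_def proj_def r_def u_def
    by (simp add: inner_diff_left zero_less_mult_iff)
  moreover have "sgn (triple u w n) = sgn (side_det s t)"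
    using hits_sgn[OF h] by (simp add: n_def u_def w_def)
  moreover have "triple u w n \<noteq> 0" using calculation(2) d by (auto simp: sgn_0_0)
  ultimately show ?thesis by (auto simp: crossing_sign_def sgn_if split: if_splits)
qed

lemma crossing_sum_eq_signed_hits:
  assumes F: "orthonormal_frame F" and d: "\<And>s t. s \<in> sides L1 \<Longrightarrow> t \<in> sides L2 \<Longrightarrow> side_det s t \<noteq> 0"
  shows "real_of_int (crossing_sum F L1 L2) =
    (\<Sum>s\<in>sides L1. \<Sum>t\<in>sides L2. signed_hit (cross3 (fst F) (snd F)) s t)"
proof -
  have hit: "signed_hit (cross3 (fst F) (snd F)) s t =
      (if passes_over F s t then real_of_int (crossing_sign F s t) else 0)"
    if "s \<in> sides L1" "t \<in> sides L2" for s t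
    using d[OF that] passes_over_iff_hits[OF F] crossing_sign_eq[OF F] by (simp add: signed_hit_def)
  have "(\<Sum>s\<in>sides L1. \<Sum>t\<in>sides L2. signed_hit (cross3 (fst F) (snd F)) s t)
     = (\<Sum>(s, t)\<in>sides L1 \<times> sides L2. signed_hit (cross3 (fst F) (snd F)) s t)"
    by (simp add: sum.cartesian_product)
  also have "\<dots> = (\<Sum>(s, t)\<in>{(s, t). s \<in> sides L1 \<and> t \<in> sides L2 \<and> passes_over F s t}.
      real_of_int (crossing_sign F s t))"
    by (intro sum.mono_neutral_cong_right) (auto simp: hit split: if_splits, auto simp: sides_def)
  finally show ?thesis by (simp add: crossing_sum_def case_prod_unfold)
qed

text \<open>A boundary pair seen at one point would put an endpoint of one projected segment on the
  other. This is no crossing of interiors, and no common endpoint either, since the projection is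
  injective on the vertices of the disjoint polygons.\<close>

lemma generic_projection_boundary_free:
  assumes gen: "generic_projection F L1 L2" and disj: "set L1 \<inter> set L2 = {}"
    and s: "s \<in> sides L1" and t: "t \<in> sides L2"
  shows "boundary_free (cross3 (fst F) (snd F)) s t"
  unfolding boundary_free_def
proof (intro allI impI notI, elim conjE)
  fix x y l :: real
  assume x: "x \<in> {0..1}" and y: "y \<in> {0..1}" and b: "x \<in> {0, 1} \<or> y \<in> {0, 1}"
    and eq: "fst s - fst t + x *\<^sub>R (snd s - fst s) - y *\<^sub>R (snd t - fst t) = l *\<^sub>R cross3 (fst F) (snd F)"
  have F: "orthonormal_frame F" and inj: "inj_on (proj F) (set L1 \<union> set L2)"
    using gen by (auto simp: generic_projection_def)
  have ends: "fst s \<in> set L1" "snd s \<in> set L1" "fst t \<in> set L2" "snd t \<in> set L2"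
    using s t unfolding sides_def by (metis prod.collapse set_rotate1 set_zip_leftD set_zip_rightD)+
  have "s \<noteq> t" using ends disj by auto
  have proj_affine: "proj F (a + k *\<^sub>R (b - a)) = (1 - k) *\<^sub>R proj F a + k *\<^sub>R proj F b" for a b k
    by (simp add: proj_def inner_add_left inner_diff_left algebra_simps)
  define p where "p = proj F (fst s + x *\<^sub>R (snd s - fst s))"
  have p': "p = proj F (fst t + y *\<^sub>R (snd t - fst t))"
    unfolding p_def proj_eq_iff[OF F] using eq by (auto simp: algebra_simps)
  have in_both: "p \<in> proj_segment F s" "p \<in> proj_segment F t"
    using x y p_def[unfolded proj_affine] p'[unfolded proj_affine]
    unfolding proj_segment_def in_segment by auto
  have ends_disj: "proj_ends F s \<inter> proj_ends F t = {}"
    using inj_on_contraD[OF inj] ends disj unfolding proj_ends_def by (auto dest!: inj_onD[OF inj])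
  have ends_not_interior: "proj_ends F c \<inter> proj_interior F c = {}" for c
    by (simp add: proj_ends_def proj_interior_def open_segment_def)
  have "p \<in> proj_ends F s \<or> p \<in> proj_ends F t"
    using b by (auto simp: p_def proj_ends_def) (auto simp: p'[unfolded p_def])
  then have not_int: "p \<notin> proj_interior F s \<inter> proj_interior F t"
    using ends_not_interior by blast
  have "s \<in> sides L1 \<union> sides L2" "t \<in> sides L1 \<union> sides L2" using s t by auto
  then have "proj_segment F s \<inter> proj_segment F t = {} \<or>
        (\<exists>p \<in> proj_ends F s \<inter> proj_ends F t. proj_segment F s \<inter> proj_segment F t = {p}) \<or>
        (\<exists>p \<in> proj_interior F s \<inter> proj_interior F t.
            proj_segment F s \<inter> proj_segment F t = {p})"
    using gen \<open>s \<noteq> t\<close> unfolding generic_projection_def by blast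
  then show False
  proof (elim disjE bexE)
    assume "proj_segment F s \<inter> proj_segment F t = {}"
    then show False using in_both by blast
  next
    fix q assume "q \<in> proj_ends F s \<inter> proj_ends F t"
    then show False using ends_disj by simp
  next
    fix q assume "q \<in> proj_interior F s \<inter> proj_interior F t" "proj_segment F s \<inter> proj_segment F t = {q}"
    then show False using in_both not_int by (metis IntI singletonD)
  qed
qed

theorem crossing_sum_independent:
  assumes "generic_projection F L1 L2" "generic_projection G L1 L2"
    and "distinct L1" "distinct L2" "set L1 \<inter> set L2 = {}"
    and "\<And>s t. s \<in> sides L1 \<Longrightarrow> t \<in> sides L2 \<Longrightarrow> side_det s t \<noteq> 0"
  shows "crossing_sum F L1 L2 = crossing_sum G L1 L2"
proof -
  have F: "orthonormal_frame F" and G: "orthonormal_frame G"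
    using assms by (auto simp: generic_projection_def)
  have nz: "cross3 (fst H) (snd H) \<noteq> 0" if "orthonormal_frame H" for H
    using orthonormal_frame_expansion(2)[OF that, of 0] by auto
  have eq: "real_of_int (crossing_sum H L1 L2) =
      (\<Sum>s\<in>sides L1. \<Sum>t\<in>sides L2. signed_hit (cross3 (fst H) (snd H)) s t)"
    if "orthonormal_frame H" for H
    using that assms(6) by (rule crossing_sum_eq_signed_hits)
  have "real_of_int (crossing_sum F L1 L2) = real_of_int (crossing_sum G L1 L2)"
    unfolding eq[OF F] eq[OF G]
    using assms generic_projection_boundary_free
    by (intro sum_signed_hit_independent nz F G conjI) auto
  then show ?thesis by simp
qed

section \<open>Crossings of sequences\<close>

fun pairsum :: "('a \<Rightarrow> 'a \<Rightarrow> int) \<Rightarrow> 'a list \<Rightarrow> int" where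
  "pairsum h (x # y # xs) = h x y + pairsum h (y # xs)"
| "pairsum h _ = 0"

lemma pairsum_split: "pairsum h (xs @ y # ys) = pairsum h (xs @ [y]) + pairsum h (y # ys)"
  by (induction xs rule: induct_list012) (auto split: list.split)

lemma pairsum_zip: "pairsum h xs = (\<Sum>(x, y)\<leftarrow>zip xs (tl xs). h x y)"
  by (induction h xs rule: pairsum.induct) auto

lemma pairsum_rev:
  "pairsum h (rev xs) = pairsum (\<lambda>x y. h y x) xs"
proof (induction h xs rule: pairsum.induct)
  case (1 h x y xs)
  have "pairsum h (rev xs @ y # [x]) = pairsum h (rev xs @ [y]) + pairsum h (y # [x])"
    by (rule pairsum_split)
  then show ?case using 1 by simp
qed auto

lemma pairsum_cong:
  "(\<And>x y. x \<in> set xs \<Longrightarrow> y \<in> set xs \<Longrightarrow> h x y = h' x y) \<Longrightarrow> pairsum h xs = pairsum h' xs"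
  by (induction h xs rule: pairsum.induct) auto

lemma pairsum_neg: "pairsum (\<lambda>x y. - h x y) xs = - pairsum h xs"
  by (induction h xs rule: pairsum.induct) auto

lemma pairsum_add: "pairsum (\<lambda>x y. h x y + h' x y) xs = pairsum h xs + pairsum h' xs"
  by (induction h xs rule: pairsum.induct) auto

lemma pairsum_zero: "pairsum (\<lambda>x y. 0) xs = 0"
  by (induction xs rule: induct_list012) auto

lemma pairsum_swap:
  "pairsum (\<lambda>x y. pairsum (h x y) ys) xs = pairsum (\<lambda>u v. pairsum (\<lambda>x y. h x y u v) xs) ys"
  by (induction xs rule: induct_list012) (simp_all add: pairsum_zero pairsum_add)

lemma pairsum_diff: "xs \<noteq> [] \<Longrightarrow> pairsum (\<lambda>x y. f y - f x) xs = f (last xs) - f (hd xs)"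
  by (induction xs rule: induct_list012) auto

lemma pairsum_chunks:
  "pairsum h (concat (map (\<lambda>t. z t # b t) [0..<T]) @ [z T]) = (\<Sum>t<T. pairsum h (z t # b t @ [z (Suc t)]))"
proof (induction T)
  case (Suc T)
  show ?case
    using pairsum_split[of h "concat (map (\<lambda>t. z t # b t) [0..<T])" "z T" "b T @ [z (Suc T)]"] Suc
    by simp
qed simp

definition above :: "'a::linorder \<Rightarrow> 'a \<Rightarrow> int" where
  "above x y = of_bool (y < x)"

text \<open>For points of the moment curve with parameters \<open>a\<close>, \<open>a'\<close>, \<open>b\<close>, \<open>b'\<close>, the segment from \<open>a\<close> to \<open>a'\<close> passes over
  the segment from \<open>b\<close> to \<open>b'\<close> in the vertical projection iff the parameters interleave and the
  largest one belongs to the first segment.  This minor of the 0-1 matrix \<open>above\<close> is, up to a global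
  sign, the sign of that crossing, and 0 if the first segment does not pass over the second.\<close>

definition crossing :: "'a::linorder \<Rightarrow> 'a \<Rightarrow> 'a \<Rightarrow> 'a \<Rightarrow> int" where
  "crossing a a' b b' = above a b * above a' b' - above a' b * above a b'"

definition crossings :: "'a::linorder list \<Rightarrow> 'a list \<Rightarrow> int" where
  "crossings P Q = pairsum (\<lambda>a a'. pairsum (crossing a a') Q) P"

lemma crossings_rev_left: "crossings (rev P) Q = - crossings P Q"
  unfolding crossings_def pairsum_rev pairsum_neg[symmetric]
  by (intro arg_cong[where f = "\<lambda>h. pairsum h P"] ext arg_cong[where f = "\<lambda>h. pairsum h Q"])
     (simp add: crossing_def)

lemma crossings_rev_right: "crossings P (rev Q) = - crossings P Q"
  unfolding crossings_def pairsum_rev pairsum_neg[symmetric]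
  by (intro arg_cong[where f = "\<lambda>h. pairsum h P"] ext arg_cong[where f = "\<lambda>h. pairsum h Q"])
     (simp add: crossing_def)

text \<open>Exchanging the sequences replaces each entry of the matrix \<open>above\<close> by its
  complement to 1. A 2 by 2 minor then changes by the mixed second difference of its entries, which
  telescopes in both sequences to their ends. For closed sequences the correction cancels, which is
  the symmetry of the linking number.\<close>

lemma crossings_commute:
  assumes "set P \<inter> set Q = {}" "P \<noteq> []" "Q \<noteq> []"
  shows "crossings Q P = crossings P Q -
    (above (last P) (last Q) - above (last P) (hd Q) - above (hd P) (last Q) + above (hd P) (hd Q))"
proof -
  have flip: "above q p = 1 - above p q" if "p \<in> set P" "q \<in> set Q" for p q
    using that assms by (auto simp: above_def)
  have "crossings Q P = pairsum (\<lambda>a a'. pairsum (\<lambda>b b'. crossing b b' a a') Q) P"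
    unfolding crossings_def by (rule pairsum_swap)
  also have "\<dots> = pairsum (\<lambda>a a'. pairsum (\<lambda>b b'. crossing a a' b b' +
     - ((above a' b' - above a b') - (above a' b - above a b))) Q) P"
    by (intro pairsum_cong) (auto simp: crossing_def flip algebra_simps)
  also have "\<dots> = crossings P Q - pairsum (\<lambda>a a'. pairsum (\<lambda>b b'. ((above a' b' - above a b') - (above a' b - above a b))) Q) P"
    unfolding pairsum_add pairsum_neg crossings_def by simp
  also have "pairsum (\<lambda>a a'. pairsum (\<lambda>b b'. ((above a' b' - above a b') - (above a' b - above a b))) Q) P
    = pairsum (\<lambda>a a'. (above a' (last Q) - above a' (hd Q)) - (above a (last Q) - above a (hd Q))) P"
    using assms by (subst pairsum_diff) (auto simp: algebra_simps)
  also have "\<dots> = (above (last P) (last Q) - above (last P) (hd Q)) - (above (hd P) (last Q) - above (hd P) (hd Q))"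
    using assms by (subst pairsum_diff) auto
  finally show ?thesis by simp
qed

lemma crossings_commute_bound:
  assumes "set P \<inter> set Q = {}" "P \<noteq> []" "Q \<noteq> []"
  shows "\<bar>crossings Q P - crossings P Q\<bar> \<le> 2"
  unfolding crossings_commute[OF assms] by (auto simp: above_def)

section \<open>Signed sums of powers of two\<close>

lemma signed_powers_of_two_bound:
  assumes "finite S" "S \<subseteq> {..<n}" "\<And>b. b \<in> S \<Longrightarrow> \<bar>\<epsilon> b\<bar> = (1::int)"
  shows "\<bar>\<Sum>b\<in>S. \<epsilon> b * 2 ^ b\<bar> < 2 ^ n"
proof -
  have "\<bar>\<Sum>b\<in>S. \<epsilon> b * 2 ^ b\<bar> \<le> (\<Sum>b\<in>S. \<bar>\<epsilon> b * 2 ^ b\<bar>)" by (rule sum_abs)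
  also have "\<dots> = (\<Sum>b\<in>S. 2 ^ b)" using assms by (intro sum.cong) (auto simp: abs_mult)
  also have "\<dots> \<le> (\<Sum>b<n. 2 ^ b)" using assms by (intro sum_mono2) auto
  also have "\<dots> < 2 ^ n" by (induction n) auto
  finally show ?thesis .
qed

text \<open>The largest power exceeds the sum of all smaller ones.\<close>

lemma signed_powers_of_two:
  assumes fin: "finite S" "S \<noteq> {}" and eps: "\<And>b. b \<in> S \<Longrightarrow> \<bar>\<epsilon> b\<bar> = (1::int)"
  shows "(\<Sum>b\<in>S. \<epsilon> b * 2 ^ b) \<noteq> 0"
proof
  define M where "M = Max S"
  have M: "M \<in> S" "\<And>b. b \<in> S \<Longrightarrow> b \<le> M" using fin by (auto simp: M_def)
  assume "(\<Sum>b\<in>S. \<epsilon> b * 2 ^ b) = 0"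
  then have "\<epsilon> M * 2 ^ M + (\<Sum>b\<in>S - {M}. \<epsilon> b * 2 ^ b) = 0"
    using fin M by (simp add: sum.remove)
  moreover have "\<bar>\<Sum>b\<in>S - {M}. \<epsilon> b * 2 ^ b\<bar> < 2 ^ M"
    using fin M eps by (intro signed_powers_of_two_bound) (force simp: order_less_le)+
  moreover have "\<bar>\<epsilon> M * 2 ^ M\<bar> = 2 ^ M" using eps M by (simp add: abs_mult)
  ultimately show False by linarith
qed

section \<open>Segments between points of the moment curve\<close>

definition moment :: "real \<Rightarrow> real^3" where
  "moment t = vector [t, t^2, t^3]"

lemma moment_nth [simp]: "moment t $ 1 = t" "moment t $ 2 = t\<^sup>2" "moment t $ 3 = t ^ 3"
  by (simp_all add: moment_def)

text \<open>Values of polynomials of degree 3 are affine functionals on the moment curve; each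
  intersection statement follows from a polynomial with suitable zeros.\<close>

lemma moment_combination:
  fixes e f g :: real
  assumes "(1 - x) *\<^sub>R moment a + x *\<^sub>R moment b = (1 - y) *\<^sub>R moment c + y *\<^sub>R moment d"
  defines "q \<equiv> \<lambda>t. (t - e) * (t - f) * (t - g)"
  shows "(1 - x) * q a + x * q b = (1 - y) * q c + y * q d"
proof -
  have *: "(1 - x) * a + x * b = (1 - y) * c + y * d"
    "(1 - x) * a\<^sup>2 + x * b\<^sup>2 = (1 - y) * c\<^sup>2 + y * d\<^sup>2"
    "(1 - x) * a^3 + x * b^3 = (1 - y) * c^3 + y * d^3"
    using assms(1) by (simp_all add: vec_eq_iff forall_3)
  have expand: "(1 - x) * q a + x * q b = ((1 - x) * a^3 + x * b^3) - (e + f + g) * ((1 - x) * a\<^sup>2 + x * b\<^sup>2)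
     + (e * f + f * g + e * g) * ((1 - x) * a + x * b) - e * f * g" for a b x
    unfolding q_def by (simp add: algebra_simps power2_eq_square power3_eq_cube)
  show ?thesis unfolding expand * ..
qed

lemma moment_segments_disjoint:
  assumes "distinct [a, b, c, d]"
  shows "closed_segment (moment a) (moment b) \<inter> closed_segment (moment c) (moment d) = {}"
proof (rule ccontr)
  assume "\<not> ?thesis"
  then obtain x y where eq: "(1 - x) *\<^sub>R moment a + x *\<^sub>R moment b = (1 - y) *\<^sub>R moment c + y *\<^sub>R moment d"
    by (auto simp: in_segment)
  \<comment> \<open>Zeros at \<open>a\<close>, \<open>c\<close>, \<open>d\<close> leave
    \<open>x = 0\<close>, and zeros at \<open>b\<close>, \<open>c\<close>, \<open>d\<close> leave
    \<open>x = 1\<close>.\<close>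
  show False
    using moment_combination[OF eq, of a c d] moment_combination[OF eq, of b c d] assms by auto
qed

lemma moment_segments_adjacent:
  assumes "distinct [a, b, c]"
  shows "closed_segment (moment a) (moment b) \<inter> closed_segment (moment a) (moment c) = {moment a}"
proof -
  have "z = moment a"
    if z: "z \<in> closed_segment (moment a) (moment b)" "z \<in> closed_segment (moment a) (moment c)" for z
  proof -
    obtain x y where zx: "z = (1 - x) *\<^sub>R moment a + x *\<^sub>R moment b"
      and eq: "(1 - x) *\<^sub>R moment a + x *\<^sub>R moment b = (1 - y) *\<^sub>R moment a + y *\<^sub>R moment c"
      using z by (auto simp: in_segment)
    \<comment> \<open>With a double zero at \<open>a\<close> and a zero at \<open>c\<close> only the
      term at \<open>b\<close> remains, so \<open>x = 0\<close>.\<close>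
    show "z = moment a"
      using moment_combination[OF eq, of a a c] assms zx by auto
  qed
  then show ?thesis by auto
qed

lemma moment_segments_inter:
  assumes "a \<noteq> b" "c \<noteq> d" "{a, b} \<noteq> {c, d}"
  shows "closed_segment (moment a) (moment b) \<inter> closed_segment (moment c) (moment d) \<subseteq> moment ` ({a, b} \<inter> {c, d})"
proof -
  consider "distinct [a, b, c, d]" | "a = c" "distinct [a, b, d]" | "a = d" "distinct [a, b, c]"
    | "b = c" "distinct [b, a, d]" | "b = d" "distinct [b, a, c]"
    using assms by auto
  then show ?thesis
  proof cases
    case 1
    then show ?thesis using moment_segments_disjoint[of a b c d] by simp
  next
    case 2
    then show ?thesis using moment_segments_adjacent[of a b d] by simp
  next
    case 3
    then show ?thesis
      using moment_segments_adjacent[of a b c]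
      by (subst closed_segment_commute[of "moment c" "moment d"]) simp
  next
    case 4
    then show ?thesis
      using moment_segments_adjacent[of b a d]
      by (subst closed_segment_commute[of "moment a" "moment b"]) simp
  next
    case 5
    then show ?thesis
      using moment_segments_adjacent[of b a c]
      by (subst closed_segment_commute[of "moment c" "moment d"], subst closed_segment_commute[of "moment a" "moment b"]) simp
  qed
qed

lemma inj_moment: "inj moment"
  by (metis injI moment_nth(1))

section \<open>Vertical crossings of chords of the moment curve\<close>

definition vertical_frame :: plane_frame where
  "vertical_frame = (axis 1 1, axis 2 1)"

lemma orthonormal_vertical_frame: "orthonormal_frame vertical_frame"
  by (simp add: vertical_frame_def orthonormal_frame_def norm_axis_1 inner_axis_axis)

lemma proj_vertical_moment: "proj vertical_frame (moment t) = (t, t\<^sup>2)"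
  by (simp add: proj_def vertical_frame_def inner_axis)

lemma cross_vertical_frame: "cross3 (fst vertical_frame) (snd vertical_frame) = axis 3 1"
  by (simp add: vertical_frame_def cross_basis)

text \<open>The signs belong to \<open>a - b\<close>, \<open>a' - b\<close>, \<open>b' - b\<close>,
  \<open>a' - a\<close>, \<open>b' - a\<close>, \<open>b' - a'\<close>, and the four implications
  express transitivity of the order. What remains is a finite check.\<close>

lemma crossing_signs:
  fixes s1 s2 s3 s4 s5 s6 :: real
  assumes "s1 = 1 \<or> s1 = - 1" "s2 = 1 \<or> s2 = - 1" "s3 = 1 \<or> s3 = - 1"
    "s4 = 1 \<or> s4 = - 1" "s5 = 1 \<or> s5 = - 1" "s6 = 1 \<or> s6 = - 1"
    and "s1 = s4 \<longrightarrow> s2 = s1" "s1 = s5 \<longrightarrow> s3 = s1" "s2 = s6 \<longrightarrow> s3 = s2" "s4 = s6 \<longrightarrow> s5 = s4"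
  shows "(if s2 * s4 * - s6 = 1 \<and> s1 * s4 * s5 = 1 \<and> s3 * s5 * - s6 = 1 \<and> s1 * s2 * s3 = 1
      then s1 * s2 * s3 * s4 * s5 * s6 else 0) =
    - ((1 + s1) / 2 * ((1 + - s6) / 2) - (1 + s2) / 2 * ((1 + - s5) / 2))"
  using assms by (elim disjE) simp_all

lemma signed_hit_moment:
  assumes "distinct [a, a', b, b']"
  shows "side_det (moment a, moment a') (moment b, moment b') \<noteq> 0"
    and "signed_hit (axis 3 1) (moment a, moment a') (moment b, moment b') = - real_of_int (crossing a a' b b')"
proof -
  define r where "r = moment a - moment b"
  define u where "u = moment a' - moment a"
  define w where "w = moment b' - moment b"
  define n where "n = (axis 3 1 :: real^3)"
  note coords = r_def u_def w_def n_def coordinates_3 axis_def power2_eq_square power3_eq_cube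
  define d where "d = side_det (moment a, moment a') (moment b, moment b')"
  \<comment> \<open>The Vandermonde determinant of the four parameters. The determinants with the
    vertical direction below are, up to sign, Vandermonde determinants of three of them.\<close>
  have d: "d = (a - b) * (a' - b) * (b' - b) * (a' - a) * (b' - a) * (b' - a')"
    unfolding d_def side_det_def by (simp add: coordinates_3 power2_eq_square power3_eq_cube algebra_simps)
  show d0: "side_det (moment a, moment a') (moment b, moment b') \<noteq> 0"
    unfolding d_def[symmetric] d using assms by auto
  have 1: "triple r w n = (a - b) * (b' - b) * (b' - a)" by (simp add: coords algebra_simps)
  have 2: "triple u w n + triple r w n = (a' - b) * (b' - b) * (b' - a')" by (simp add: coords algebra_simps)
  have 3: "triple r u n = (a - b) * (a' - a) * (a' - b)" by (simp add: coords algebra_simps)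
  have 4: "triple u w n + triple r u n = (a - b') * (a' - a) * (a' - b')" by (simp add: coords algebra_simps)
  have hit: "hits n (moment a, moment a') (moment b, moment b') \<longleftrightarrow> 0 < - d * triple r w n \<and> 0 < d * (triple u w n + triple r w n) \<and>
    0 < - d * triple r u n \<and> 0 < d * (triple u w n + triple r u n)"
    using hits_iff_det[OF d0, of n] by (simp add: r_def u_def w_def d_def)
  have square: "0 < k\<^sup>2 * p \<longleftrightarrow> 0 < p" if "k \<noteq> 0" for k p :: real
    using that by (simp add: zero_less_mult_iff)
  \<comment> \<open>A square times three differences: whether the sides hit depends only on signs of
    differences, that is, on the order of the parameters.\<close>
  have factors1: "- d * triple r w n = ((a - b) * (b' - b) * (b' - a))\<^sup>2 * ((a' - b) * (a' - a) * (a' - b'))"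
    unfolding 1 d by algebra
  have factors2: "d * (triple u w n + triple r w n) = ((a' - b) * (b' - b) * (b' - a'))\<^sup>2 * ((a - b) * (a' - a) * (b' - a))"
    unfolding 2 d by algebra
  have factors3: "- d * triple r u n = ((a - b) * (a' - a) * (a' - b))\<^sup>2 * ((b' - b) * (b' - a) * (a' - b'))"
    unfolding 3 d by algebra
  have factors4: "d * (triple u w n + triple r u n) = ((a' - a) * (b' - a) * (b' - a'))\<^sup>2 * ((a - b) * (a' - b) * (b' - b))"
    unfolding 4 d by algebra
  have hit': "hits n (moment a, moment a') (moment b, moment b') \<longleftrightarrow>
    0 < (a' - b) * (a' - a) * (a' - b') \<and> 0 < (a - b) * (a' - a) * (b' - a) \<and>
    0 < (b' - b) * (b' - a) * (a' - b') \<and> 0 < (a - b) * (a' - b) * (b' - b)"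
    unfolding hit factors1 factors2 factors3 factors4 using assms by (simp add: square)
  have pos_sgn: "0 < p \<longleftrightarrow> sgn p = 1" for p :: real by (simp add: sgn_1_pos)
  have diff_sgn: "sgn (x - y) = 1 \<or> sgn (x - y) = - 1" if "x \<noteq> y" for x y :: real
    using that by (auto simp: sgn_if)
  have above_sgn: "real_of_int (above x y) = (1 + sgn (x - y)) / 2" if "x \<noteq> y" for x y :: real
    using that by (auto simp: above_def sgn_if)
  have sgn_trans: "sgn (x - y) = sgn (z - x) \<longrightarrow> sgn (z - y) = sgn (x - y)" for x y z :: real
    by (auto simp: sgn_if)
  have flip: "sgn (a' - b') = - sgn (b' - a')" "sgn (a - b') = - sgn (b' - a)"
    by (simp_all flip: sgn_minus)
  have "signed_hit n (moment a, moment a') (moment b, moment b') =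
    (if sgn (a' - b) * sgn (a' - a) * - sgn (b' - a') = 1 \<and> sgn (a - b) * sgn (a' - a) * sgn (b' - a) = 1 \<and>
        sgn (b' - b) * sgn (b' - a) * - sgn (b' - a') = 1 \<and> sgn (a - b) * sgn (a' - b) * sgn (b' - b) = 1
     then sgn (a - b) * sgn (a' - b) * sgn (b' - b) * sgn (a' - a) * sgn (b' - a) * sgn (b' - a') else 0)"
    unfolding signed_hit_def hit' d_def[symmetric] d pos_sgn sgn_mult flip ..
  also have "\<dots> = - ((1 + sgn (a - b)) / 2 * ((1 + - sgn (b' - a')) / 2) - (1 + sgn (a' - b)) / 2 * ((1 + - sgn (b' - a)) / 2))"
    using assms by (intro crossing_signs diff_sgn sgn_trans) auto
  also have "\<dots> = - real_of_int (crossing a a' b b')"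
    using assms by (simp add: crossing_def above_sgn flip)
  finally show "signed_hit (axis 3 1) (moment a, moment a') (moment b, moment b') = - real_of_int (crossing a a' b b')"
    by (simp add: n_def)
qed


text \<open>The concurrency determinant of three chords of the parabola is a signed sum of 12 products of
  three parameters.  With these parameters the products are distinct powers of 2.\<close>

definition param :: "nat \<Rightarrow> real" where
  "param k = 2 ^ (2 ^ k)"

lemma strict_mono_param: "strict_mono param"
  by (auto simp: strict_mono_def param_def)

text \<open>The exponents \<open>2 ^ i\<close>, \<open>2 ^ j\<close>, \<open>2 ^ k\<close> add
  without carry, so the product remembers which three parameters it came from.\<close>

lemma param_product:
  assumes "distinct [i, j, k]"
  shows "param i * param j * param k = 2 ^ set_encode {i, j, k}"
  using assms by (simp add: param_def set_encode_def power_add add.assoc)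

lemma no_concurrent_chords:
  assumes "distinct [a, b, c, d, e, f :: nat]"
  shows "(param c + param d) * (param e * param f) - (param e + param f) * (param c * param d)
     - (param a + param b) * (param e * param f) + (param e + param f) * (param a * param b)
     + (param a + param b) * (param c * param d) - (param c + param d) * (param a * param b) \<noteq> 0"
proof
  define x where "x = (!) [a, b, c, d, e, f]"
  define enc where "enc I = set_encode (x ` I)" for I
  \<comment> \<open>Expanding the determinant gives six monomials with coefficient 1 and six with
    coefficient -1; \<open>P\<close> and \<open>N\<close> list their index sets, where 0, ..., 5
    stand for \<open>a\<close>, ..., \<open>f\<close>.\<close>
  define P where "P = [{2,4,5}, {3,4,5}, {0,1,4}, {0,1,5}, {0,2,3}, {1,2,3::nat}]"
  define N where "N = [{2,3,4}, {2,3,5}, {0,4,5}, {1,4,5}, {0,1,2}, {0,1,3::nat}]"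
  have PN: "distinct P" "distinct N" "set P \<inter> set N = {}"
    unfolding P_def N_def by code_simp+
  have sub: "set P \<union> set N \<subseteq> Pow {..<6}" by (auto simp: P_def N_def)
  have inj_x: "inj_on x {..<6}"
    using assms unfolding x_def by (intro inj_on_nth) auto
  have inj_enc: "inj_on enc (Pow {..<6})"
  proof (rule inj_onI)
    fix I J assume *: "I \<in> Pow {..<6::nat}" "J \<in> Pow {..<6::nat}" "enc I = enc J"
    then have "x ` I = x ` J"
      unfolding enc_def by (metis Pow_iff finite_imageI finite_lessThan finite_subset set_encode_eq)
    then show "I = J" using * inj_on_image_eq_iff[OF inj_x] by auto
  qed
  have sum_eq: "(\<Sum>I\<leftarrow>Q. 2 ^ enc I) = set_encode (enc ` set Q)" if "distinct Q" "set Q \<subseteq> Pow {..<6}" for Q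
  proof -
    have "(\<Sum>I\<leftarrow>Q. 2 ^ enc I) = (\<Sum>I\<in>set Q. 2 ^ enc I)"
      using that by (simp add: sum.distinct_set_conv_list)
    also have "\<dots> = sum ((^) 2) (enc ` set Q)"
      using inj_on_subset[OF inj_enc that(2)] by (simp add: sum.reindex)
    finally show ?thesis by (simp add: set_encode_def)
  qed
  have monomial: "(2::real) ^ enc {i, j, k} = param (x i) * param (x j) * param (x k)"
    if "distinct [x i, x j, x k]" for i j k
    using param_product[OF that] by (simp add: enc_def)
  have xs: "x 0 = a" "x 1 = b" "x 2 = c" "x 3 = d" "x 4 = e" "x 5 = f"
    by (simp_all add: x_def)
  assume "(param c + param d) * (param e * param f) - (param e + param f) * (param c * param d)
     - (param a + param b) * (param e * param f) + (param e + param f) * (param a * param b)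
     + (param a + param b) * (param c * param d) - (param c + param d) * (param a * param b) = 0"
  then have "real (\<Sum>I\<leftarrow>P. 2 ^ enc I) = real (\<Sum>I\<leftarrow>N. 2 ^ enc I)"
    using assms unfolding P_def N_def by (simp add: monomial xs del: One_nat_def) (simp add: algebra_simps)
  \<comment> \<open>Both sides are sums of distinct powers of 2, so uniqueness of binary digits
    identifies the sets of exponents and then the index sets.\<close>
  then have "set_encode (enc ` set P) = set_encode (enc ` set N)"
    using sum_eq PN sub by simp
  then have "enc ` set P = enc ` set N"
    by (simp add: set_encode_eq)
  then have "set P = set N"
    using inj_on_image_eq_iff[OF inj_enc] sub by simp
  then show False using PN(3) by (simp add: P_def)
qed

definition node :: "nat \<Rightarrow> real^3" where
  "node k = moment (param k)"

lemma param_inj [simp]: "param j = param k \<longleftrightarrow> j = k"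
  using strict_mono_eq[OF strict_mono_param] .

lemma inj_node: "inj node"
  unfolding node_def by (rule injI) (metis inj_moment injD param_inj)

lemma node_eq_iff [simp]: "node j = node k \<longleftrightarrow> j = k"
  using inj_node by (auto simp: inj_def)

lemma node_segments_inter:
  assumes "a \<noteq> b" "c \<noteq> d" "{a, b} \<noteq> {c, d}"
  shows "closed_segment (node a) (node b) \<inter> closed_segment (node c) (node d) \<subseteq> node ` ({a, b} \<inter> {c, d})"
proof -
  have "{param a, param b} \<noteq> {param c, param d}"
    using assms(3) by (auto simp: doubleton_eq_iff)
  then show ?thesis
    using moment_segments_inter[of "param a" "param b" "param c" "param d"] assms(1,2)
    unfolding node_def by auto
qed

section \<open>Chords of a parabola, the vertical projections of the segments\<close>

definition chord_end :: "real \<Rightarrow> real \<times> real" where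
  "chord_end t = (t, t\<^sup>2)"

lemma chord_combination:
  fixes e f :: real
  assumes "(1 - x) *\<^sub>R chord_end a + x *\<^sub>R chord_end b = (1 - y) *\<^sub>R chord_end c + y *\<^sub>R chord_end d"
  defines "q \<equiv> \<lambda>t. (t - e) * (t - f)"
  shows "(1 - x) * q a + x * q b = (1 - y) * q c + y * q d"
proof -
  have *: "(1 - x) * a + x * b = (1 - y) * c + y * d"
    "(1 - x) * a\<^sup>2 + x * b\<^sup>2 = (1 - y) * c\<^sup>2 + y * d\<^sup>2"
    using assms(1) by (simp_all add: chord_end_def)
  have expand: "(1 - x) * q a + x * q b = ((1 - x) * a\<^sup>2 + x * b\<^sup>2) - (e + f) * ((1 - x) * a + x * b) + e * f" for a b x
    unfolding q_def by (simp add: algebra_simps power2_eq_square)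
  show ?thesis unfolding expand * ..
qed

lemma chords_adjacent:
  assumes "distinct [a, b, c]"
  shows "closed_segment (chord_end a) (chord_end b) \<inter> closed_segment (chord_end a) (chord_end c) = {chord_end a}"
proof -
  have "z = chord_end a"
    if z: "z \<in> closed_segment (chord_end a) (chord_end b)" "z \<in> closed_segment (chord_end a) (chord_end c)" for z
  proof -
    obtain x y where zx: "z = (1 - x) *\<^sub>R chord_end a + x *\<^sub>R chord_end b"
      and eq: "(1 - x) *\<^sub>R chord_end a + x *\<^sub>R chord_end b = (1 - y) *\<^sub>R chord_end a + y *\<^sub>R chord_end c"
      using z by (auto simp: in_segment)
    show "z = chord_end a"
      using chord_combination[OF eq, of a c] assms zx by auto
  qed
  then show ?thesis by auto
qed

text \<open>Strict convexity of the parabola, tested with the polynomial that has a double zero at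
  \<open>a\<close> and is positive elsewhere.\<close>

lemma chord_end_notin_chord:
  assumes "a \<noteq> c" "a \<noteq> d"
  shows "chord_end a \<notin> closed_segment (chord_end c) (chord_end d)"
proof
  assume "chord_end a \<in> closed_segment (chord_end c) (chord_end d)"
  then obtain y where y: "0 \<le> y" "y \<le> 1"
    and eq: "(1 - 0) *\<^sub>R chord_end a + 0 *\<^sub>R chord_end a = (1 - y) *\<^sub>R chord_end c + y *\<^sub>R chord_end d"
    by (auto simp: in_segment)
  have "(1 - y) * (c - a)\<^sup>2 + y * (d - a)\<^sup>2 = 0"
    using chord_combination[OF eq, of a a] by (simp add: power2_eq_square)
  moreover have "0 \<le> (1 - y) * (c - a)\<^sup>2" "0 \<le> y * (d - a)\<^sup>2" using y by auto
  ultimately have "(1 - y) * (c - a)\<^sup>2 = 0" "y * (d - a)\<^sup>2 = 0" by linarith+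
  then show False using assms by auto
qed

lemma chords_disjoint_ends:
  assumes "distinct [a, b, c, d]"
    and p: "p \<in> closed_segment (chord_end a) (chord_end b)" "p \<in> closed_segment (chord_end c) (chord_end d)"
  shows "p \<in> open_segment (chord_end a) (chord_end b)" "p \<in> open_segment (chord_end c) (chord_end d)"
    and "closed_segment (chord_end a) (chord_end b) \<inter> closed_segment (chord_end c) (chord_end d) = {p}"
proof -
  show "p \<in> open_segment (chord_end a) (chord_end b)" "p \<in> open_segment (chord_end c) (chord_end d)"
    using p assms(1) chord_end_notin_chord[of a c d] chord_end_notin_chord[of b c d]
      chord_end_notin_chord[of c a b] chord_end_notin_chord[of d a b]
    by (auto simp: open_segment_def)
  have "p = p'" if p': "p' \<in> closed_segment (chord_end a) (chord_end b)" "p' \<in> closed_segment (chord_end c) (chord_end d)" for p'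
  proof -
    define q where "q t = (t - c) * (t - d)" for t
    obtain x y where px: "p = (1 - x) *\<^sub>R chord_end a + x *\<^sub>R chord_end b"
      and eq: "(1 - x) *\<^sub>R chord_end a + x *\<^sub>R chord_end b = (1 - y) *\<^sub>R chord_end c + y *\<^sub>R chord_end d"
      using p by (auto simp: in_segment)
    obtain x' y' where px': "p' = (1 - x') *\<^sub>R chord_end a + x' *\<^sub>R chord_end b"
      and eq': "(1 - x') *\<^sub>R chord_end a + x' *\<^sub>R chord_end b = (1 - y') *\<^sub>R chord_end c + y' *\<^sub>R chord_end d"
      using p' by (auto simp: in_segment)
    \<comment> \<open>Zeros at \<open>c\<close> and \<open>d\<close> remove the second chord, and
      \<open>x\<close> solves an affine equation. Its slope \<open>q b - q a\<close> is not zero,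
      since otherwise \<open>q a\<close> itself would vanish.\<close>
    have 1: "(1 - x) * q a + x * q b = 0" "(1 - x') * q a + x' * q b = 0"
      using chord_combination[OF eq, of c d] chord_combination[OF eq', of c d] by (simp_all add: q_def)
    then have "(x - x') * (q b - q a) = 0" by algebra
    moreover have "q b \<noteq> q a"
    proof
      assume "q b = q a"
      then have "q a = 0" using 1(1) by (simp add: algebra_simps)
      then show False using assms(1) by (simp add: q_def)
    qed
    ultimately have "x = x'" by simp
    then show ?thesis using px px' by simp
  qed
  then show "closed_segment (chord_end a) (chord_end b) \<inter> closed_segment (chord_end c) (chord_end d) = {p}"
    using p by blast
qed

text \<open>The cases are those of \<open>generic_projection\<close>. In the crossing case
  distinctness of the parameters is recorded too: three mutually crossing chords then have six
  different ends, as \<open>no_concurrent_chords\<close> requires.\<close>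

lemma chords_trichotomy:
  assumes "a \<noteq> b" "c \<noteq> d" "{a, b} \<noteq> {c, d}"
  defines "S \<equiv> closed_segment (chord_end a) (chord_end b)" and "T \<equiv> closed_segment (chord_end c) (chord_end d)"
  shows "S \<inter> T = {} \<or>
    (\<exists>p\<in>{chord_end a, chord_end b} \<inter> {chord_end c, chord_end d}. S \<inter> T = {p}) \<or>
    (\<exists>p\<in>open_segment (chord_end a) (chord_end b) \<inter> open_segment (chord_end c) (chord_end d). S \<inter> T = {p} \<and> distinct [a, b, c, d])"
proof -
  note comm = closed_segment_commute
  consider "distinct [a, b, c, d]" | "a = c" "distinct [a, b, d]" | "a = d" "distinct [a, b, c]"
    | "b = c" "distinct [b, a, d]" | "b = d" "distinct [b, a, c]"
    using assms by auto
  then show ?thesis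
  proof cases
    case 1
    then show ?thesis using chords_disjoint_ends[OF 1] unfolding S_def T_def by blast
  next
    case 2
    then show ?thesis using chords_adjacent[of a b d] by (simp add: S_def T_def)
  next
    case 3
    then have "S \<inter> T = {chord_end a}"
      using chords_adjacent[of a b c] unfolding S_def T_def by (subst comm[of "chord_end c"]) simp
    then show ?thesis using 3 by simp
  next
    case 4
    then have "S \<inter> T = {chord_end b}"
      using chords_adjacent[of b a d] unfolding S_def T_def by (subst comm[of "chord_end a"]) simp
    then show ?thesis using 4 by simp
  next
    case 5
    then have "S \<inter> T = {chord_end b}"
      using chords_adjacent[of b a c] unfolding S_def T_def
      by (subst comm[of "chord_end c"], subst comm[of "chord_end a"]) simp
    then show ?thesis using 5 by simp
  qed
qed

text \<open>The equation of the secant, solved for the product of the parameters. Substituting it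
  for three chords through one point makes the determinant of \<open>no_concurrent_chords\<close>
  vanish identically.\<close>

lemma on_chord:
  assumes "(X, Y) \<in> open_segment (chord_end a) (chord_end b)"
  shows "a * b = (a + b) * X - Y"
proof -
  obtain x where XY: "X = (1 - x) * a + x * b" "Y = (1 - x) * a\<^sup>2 + x * b\<^sup>2"
    using assms by (auto simp: in_segment chord_end_def)
  show ?thesis unfolding XY by algebra
qed

lemma set_zip_rotate1:
  "set (zip L (rotate1 L)) = (\<lambda>i. (L ! i, L ! (Suc i mod length L))) ` {..<length L}"
  by (auto simp: set_zip nth_rotate1 image_iff)

lemma proj_node: "proj vertical_frame (node k) = chord_end (param k)"
  by (simp add: node_def proj_vertical_moment chord_end_def)

lemma sides_map: "sides (map f L) = map_prod f f ` set (zip L (rotate1 L))"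
  unfolding sides_def by (simp add: rotate1_map zip_map_map map_prod_def)

lemma cyclic_pairs:
  assumes "distinct L" "3 \<le> length L"
  shows "(a, b) \<in> set (zip L (rotate1 L)) \<Longrightarrow> a \<noteq> b"
    and "(a, b) \<in> set (zip L (rotate1 L)) \<Longrightarrow> (c, d) \<in> set (zip L (rotate1 L)) \<Longrightarrow> (a, b) \<noteq> (c, d) \<Longrightarrow> {a, b} \<noteq> {c, d}"
proof -
  define n where "n = length L"
  have n: "3 \<le> n" using assms by (simp add: n_def)
  have nth: "L ! i = L ! j \<longleftrightarrow> i = j" if "i < n" "j < n" for i j
    using that assms by (simp add: nth_eq_iff_index_eq n_def)
  have suc: "Suc i mod n < n" "Suc i mod n = (if Suc i = n then 0 else Suc i)" if "i < n" for i
    using that by auto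
  \<comment> \<open>Length at least 3 enters here: two steps along the cycle do not return, so no
    pair of neighbours is traversed in both directions.\<close>
  have ne: "Suc i mod n \<noteq> i" "Suc (Suc i mod n) mod n \<noteq> i" if "i < n" for i
    using that n suc[of i] suc[of "Suc i mod n"] by (auto split: if_splits)
  show "a \<noteq> b" if "(a, b) \<in> set (zip L (rotate1 L))"
    using that ne nth suc unfolding set_zip_rotate1 n_def[symmetric] by force
  show "{a, b} \<noteq> {c, d}" if ab: "(a, b) \<in> set (zip L (rotate1 L))" and cd: "(c, d) \<in> set (zip L (rotate1 L))" and "(a, b) \<noteq> (c, d)"
  proof -
    obtain i where i: "i < n" "a = L ! i" "b = L ! (Suc i mod n)"
      using ab unfolding set_zip_rotate1 n_def[symmetric] by auto
    obtain j where j: "j < n" "c = L ! j" "d = L ! (Suc j mod n)"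
      using cd unfolding set_zip_rotate1 n_def[symmetric] by auto
    show ?thesis
    proof
      assume "{a, b} = {c, d}"
      then have "a = d" "b = c" using that(3) i j nth by (auto simp: doubleton_eq_iff)
      then have "i = Suc j mod n" "Suc i mod n = j" using i j nth suc by auto
      then show False using ne(2)[OF i(1)] i j by simp
    qed
  qed
qed

lemma generic_projection_vertical:
  assumes L1: "distinct L1" "3 \<le> length L1" and L2: "distinct L2" "3 \<le> length L2"
    and disj: "set L1 \<inter> set L2 = {}"
  shows "generic_projection vertical_frame (map node L1) (map node L2)"
proof -
  define C where "C = set (zip L1 (rotate1 L1)) \<union> set (zip L2 (rotate1 L2))"
  have sides: "sides (map node L1) \<union> sides (map node L2) = map_prod node node ` C"
    unfolding sides_map C_def by auto
  have in1: "a \<in> set L1" "b \<in> set L1" if "(a, b) \<in> set (zip L1 (rotate1 L1))" for a b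
    using that by (metis set_zip_leftD, metis set_rotate1 set_zip_rightD)
  have in2: "a \<in> set L2" "b \<in> set L2" if "(a, b) \<in> set (zip L2 (rotate1 L2))" for a b
    using that by (metis set_zip_leftD, metis set_rotate1 set_zip_rightD)
  have ne: "a \<noteq> b" if "(a, b) \<in> C" for a b
    using that cyclic_pairs(1)[OF L1] cyclic_pairs(1)[OF L2] unfolding C_def by blast
  have ne2: "{a, b} \<noteq> {c, d}" if abcd: "(a, b) \<in> C" "(c, d) \<in> C" "(a, b) \<noteq> (c, d)" for a b c d
  proof -
    consider "(a, b) \<in> set (zip L1 (rotate1 L1))" "(c, d) \<in> set (zip L1 (rotate1 L1))"
      | "(a, b) \<in> set (zip L2 (rotate1 L2))" "(c, d) \<in> set (zip L2 (rotate1 L2))"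
      | "a \<in> set L1" "c \<in> set L2" "d \<in> set L2" | "a \<in> set L2" "c \<in> set L1" "d \<in> set L1"
      using abcd(1,2) in1 in2 unfolding C_def by blast
    then show ?thesis
    proof cases
      case 1
      then show ?thesis using cyclic_pairs(2)[OF L1 _ _ abcd(3)] by simp
    next
      case 2
      then show ?thesis using cyclic_pairs(2)[OF L2 _ _ abcd(3)] by simp
    qed (use disj in \<open>auto simp: doubleton_eq_iff\<close>)
  qed
  note tri = chords_trichotomy[of "param a" "param b" "param c" "param d" for a b c d]
  have segs: "proj_segment vertical_frame (node a, node b) = closed_segment (chord_end (param a)) (chord_end (param b))"
    "proj_interior vertical_frame (node a, node b) = open_segment (chord_end (param a)) (chord_end (param b))"
    "proj_ends vertical_frame (node a, node b) = {chord_end (param a), chord_end (param b)}" for a b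
    by (simp_all add: proj_segment_def proj_interior_def proj_ends_def proj_node)
  have pair: "{param a, param b} \<noteq> {param c, param d}" if "{a, b} \<noteq> {c, d}" for a b c d
    using that by (auto simp: doubleton_eq_iff)
  have inj: "inj_on (proj vertical_frame) (set (map node L1) \<union> set (map node L2))"
    by (auto simp: inj_on_def proj_node chord_end_def)
  have two: "proj_segment vertical_frame s \<inter> proj_segment vertical_frame t = {} \<or>
        (\<exists>p \<in> proj_ends vertical_frame s \<inter> proj_ends vertical_frame t. proj_segment vertical_frame s \<inter> proj_segment vertical_frame t = {p}) \<or>
        (\<exists>p \<in> proj_interior vertical_frame s \<inter> proj_interior vertical_frame t.
            proj_segment vertical_frame s \<inter> proj_segment vertical_frame t = {p})"
    if st: "s \<in> map_prod node node ` C" "t \<in> map_prod node node ` C" "s \<noteq> t" for s t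
  proof -
    obtain a b where s: "(a, b) \<in> C" "s = (node a, node b)" using st by auto
    obtain c d where t: "(c, d) \<in> C" "t = (node c, node d)" using st by auto
    have "(a, b) \<noteq> (c, d)" using st s t by auto
    then show ?thesis
      using tri[of a b c d] ne[OF s(1)] ne[OF t(1)] pair[OF ne2[OF s(1) t(1)]]
      unfolding s t segs by auto
  qed
  have six: "distinct [a, b, c, d]" if "(a, b) \<in> C" "(c, d) \<in> C" "(a, b) \<noteq> (c, d)"
     "p \<in> open_segment (chord_end (param a)) (chord_end (param b))" "p \<in> open_segment (chord_end (param c)) (chord_end (param d))"
     for a b c d p
  proof -
    have "p \<in> closed_segment (chord_end (param a)) (chord_end (param b)) \<inter> closed_segment (chord_end (param c)) (chord_end (param d))"
      "p \<notin> {chord_end (param a), chord_end (param b)}"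
      using that(4,5) by (auto simp: open_segment_def)
    then have "distinct [param a, param b, param c, param d]"
      using tri[of a b c d] ne[OF that(1)] ne[OF that(2)] pair[OF ne2[OF that(1-3)]] by auto
    then show ?thesis by simp
  qed
  have three: "proj_interior vertical_frame r \<inter> proj_interior vertical_frame s \<inter> proj_interior vertical_frame t = {}"
    if rst: "r \<in> map_prod node node ` C" "s \<in> map_prod node node ` C" "t \<in> map_prod node node ` C"
      "r \<noteq> s" "s \<noteq> t" "r \<noteq> t" for r s t
  proof (rule ccontr)
    assume ne: "\<not> ?thesis"
    obtain a b where r: "(a, b) \<in> C" "r = (node a, node b)" using rst by auto
    obtain c d where s: "(c, d) \<in> C" "s = (node c, node d)" using rst by auto
    obtain e f where t: "(e, f) \<in> C" "t = (node e, node f)" using rst by auto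
    obtain X Y where p: "(X, Y) \<in> open_segment (chord_end (param a)) (chord_end (param b))"
      "(X, Y) \<in> open_segment (chord_end (param c)) (chord_end (param d))"
      "(X, Y) \<in> open_segment (chord_end (param e)) (chord_end (param f))"
      using ne unfolding r s t segs by auto
    have "(a, b) \<noteq> (c, d)" "(c, d) \<noteq> (e, f)" "(a, b) \<noteq> (e, f)" using rst r s t by auto
    then have "distinct [a, b, c, d]" "distinct [c, d, e, f]" "distinct [a, b, e, f]"
      using six r(1) s(1) t(1) p by metis+
    then have "distinct [a, b, c, d, e, f]" by auto
    from no_concurrent_chords[OF this] show False
      unfolding p[THEN on_chord] by (simp add: algebra_simps)
  qed
  show ?thesis
    unfolding generic_projection_def sides
    using orthonormal_vertical_frame inj two three by blast
qed

section \<open>Routes with prescribed crossing numbers\<close>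

lemma above_strict_mono: "strict_mono f \<Longrightarrow> above (f x) (f y) = above x y"
  for f :: "'a::linorder \<Rightarrow> 'b::linorder"
  by (simp add: above_def strict_mono_less)

lemma crossing_strict_mono: "strict_mono f \<Longrightarrow> crossing (f a) (f a') (f b) (f b') = crossing a a' b b'"
  for f :: "'a::linorder \<Rightarrow> 'b::linorder"
  by (simp add: crossing_def above_strict_mono)

text \<open>\<open>crossing\<close> is a 2 by 2 minor of the matrix \<open>above\<close>, with rows
  indexed by the first sequence. Equal rows here and a zero row in the next lemma dispose of all
  segments without a matching excursion.\<close>

lemma crossing_equal_rows:
  assumes "\<And>q. q \<in> set Q \<Longrightarrow> above x q = above x' q"
  shows "pairsum (crossing x x') Q = 0"
proof -
  have "pairsum (crossing x x') Q = pairsum (\<lambda>_ _. 0) Q"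
    using assms by (intro pairsum_cong) (simp add: crossing_def)
  then show ?thesis by (simp add: pairsum_zero)
qed

lemma crossing_zero_row:
  assumes "(\<forall>q\<in>set Q. x < q) \<or> (\<forall>q\<in>set Q. x' < q)"
  shows "pairsum (crossing x x') Q = 0"
proof -
  have "pairsum (crossing x x') Q = pairsum (\<lambda>_ _. 0) Q"
    using assms by (intro pairsum_cong) (auto simp: crossing_def above_def)
  then show ?thesis by (simp add: pairsum_zero)
qed

lemma pairsum_join:
  assumes "P \<noteq> []" "Q \<noteq> []" "last P = hd Q"
  shows "pairsum h (butlast P @ Q) = pairsum h P + pairsum h Q"
  using pairsum_split[of h "butlast P" "hd Q" "tl Q"] assms
  by (metis append_butlast_last_id list.collapse)

text \<open>Ranks are ordered as: base points (by route), vertices, slots (four for each entry \<open>(i, j)\<close> of \<open>ps\<close>).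
  At the entry \<open>t\<close> the routes \<open>i\<close> and \<open>j\<close> make interleaved excursions from their base points to
  the slots 0, 2 and 1, 3 of the entry.  This adds exactly one crossing of route \<open>i\<close> over route \<open>j\<close>;
  all other segments contribute nothing to the crossings of an earlier route over a later one.\<close>

locale gadgets =
  fixes m n :: nat and ps :: "(nat \<times> nat) list"
  assumes ps_ordered: "\<And>i j. (i, j) \<in> set ps \<Longrightarrow> i < j"
begin

text \<open>Blocks of \<open>Suc (length ps)\<close> ranks, because a route has a base point before
  each entry and one after the last.\<close>

definition base :: "nat \<Rightarrow> nat \<Rightarrow> nat" where
  "base j t = j * Suc (length ps) + t"

definition vertex :: "nat \<Rightarrow> nat" where
  "vertex k = m * Suc (length ps) + k"

definition slot :: "nat \<Rightarrow> nat \<Rightarrow> nat" where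
  "slot t c = m * Suc (length ps) + n + 4 * t + c"

definition chunk :: "nat \<Rightarrow> nat \<Rightarrow> nat list" where
  "chunk j t = (if j = fst (ps ! t) then [slot t 0, slot t 2]
     else if j = snd (ps ! t) then [slot t 1, slot t 3] else [])"

definition route :: "nat \<Rightarrow> nat \<Rightarrow> nat \<Rightarrow> nat list" where
  "route j u v = vertex u # concat (map (\<lambda>t. base j t # chunk j t) [0..<length ps]) @ [base j (length ps), vertex v]"

lemma base_less_base: "i < j \<Longrightarrow> t \<le> length ps \<Longrightarrow> base i t < base j s"
proof -
  assume "i < j" "t \<le> length ps"
  have "base i t < Suc i * Suc (length ps)" using \<open>t \<le> length ps\<close> by (simp add: base_def)
  also have "\<dots> \<le> j * Suc (length ps)" using \<open>i < j\<close> by (intro mult_le_mono1) simp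
  also have "\<dots> \<le> base j s" by (simp add: base_def)
  finally show ?thesis .
qed

lemma base_less_vertex: "i < m \<Longrightarrow> t \<le> length ps \<Longrightarrow> base i t < vertex k"
  using base_less_base[of i m t 0] by (simp add: base_def vertex_def)

lemma vertex_less_slot: "k < n \<Longrightarrow> vertex k < slot t c"
  by (simp add: vertex_def slot_def)

lemma base_less_slot: "i < m \<Longrightarrow> t \<le> length ps \<Longrightarrow> base i t < slot s c"
  using base_less_base[of i m t 0] by (simp add: base_def slot_def)

lemma slot_less_slot: "s < t \<Longrightarrow> c \<le> 3 \<Longrightarrow> slot s c < slot t d"
  by (simp add: slot_def)

lemma set_chunk: "q \<in> set (chunk j t) \<Longrightarrow> \<exists>c\<le>3. q = slot t c"
  unfolding chunk_def by (auto split: if_splits intro: exI[of _ 0] exI[of _ 1] exI[of _ 2] exI[of _ 3])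

lemma set_route_cases:
  assumes "q \<in> set (route j u v)"
  obtains "q = vertex u" | "q = vertex v" | t where "t \<le> length ps" "q = base j t"
    | t where "t < length ps" "q \<in> set (chunk j t)"
proof -
  have "q = vertex u \<or> q = vertex v \<or> (\<exists>t\<le>length ps. q = base j t) \<or> (\<exists>t<length ps. q \<in> set (chunk j t))"
    using assms unfolding route_def by auto (metis less_imp_le)
  then show thesis using that by blast
qed

lemma hd_last_route [simp]: "hd (route j u v) = vertex u" "last (route j u v) = vertex v"
  by (simp_all add: route_def)

lemma length_route: "3 \<le> length (route j u v)"
  by (simp add: route_def)

lemma vertex_in_route:
  assumes "vertex k \<in> set (route j u v)" "j < m" "k < n"
  shows "k = u \<or> k = v"
  using assms(1)
proof (cases rule: set_route_cases)
  case (3 t)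
  then show ?thesis using base_less_vertex[OF assms(2), of t k] by simp
next
  case (4 t)
  then show ?thesis using set_chunk[of _ j t] vertex_less_slot[OF assms(3)] by fastforce
qed (auto simp: vertex_def)

lemma distinct_route:
  assumes "j < m" "u < n" "v < n" "u \<noteq> v"
  shows "distinct (route j u v)"
proof -
  have chunk_disj: "set (chunk j s) \<inter> set (chunk j t) = {}" if "s \<noteq> t" for s t
    using set_chunk[of _ j s] set_chunk[of _ j t] slot_less_slot[of s t] slot_less_slot[of t s] that
    by (metis disjoint_iff less_irrefl nat_neq_iff)
  have base_chunk: "base j t \<notin> set (chunk j s)" if "t \<le> length ps" for s t
    using set_chunk[of _ j s] base_less_slot[OF assms(1) that] by (metis less_irrefl)
  have vertex_chunk: "vertex k \<notin> set (chunk j s)" if "k < n" for k s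
    using set_chunk[of _ j s] vertex_less_slot[OF that] by (metis less_irrefl)
  have vertex_base: "vertex k \<noteq> base j t" if "t \<le> length ps" for k t
    using base_less_vertex[OF assms(1) that] by (metis less_irrefl)
  have vertex_inj: "vertex k = vertex l \<longleftrightarrow> k = l" for k l by (simp add: vertex_def)
  have base_inj: "base j s = base j t \<longleftrightarrow> s = t" for s t by (simp add: base_def)
  have chunk_unique: "s = t" if "q \<in> set (chunk j s)" "q \<in> set (chunk j t)" for q s t
    using chunk_disj[of s t] that by blast
  have "distinct (chunk j t)" for t by (simp add: chunk_def slot_def)
  then have "distinct (concat (map (\<lambda>t. base j t # chunk j t) [0..<length ps]))"
    using base_chunk chunk_unique base_inj
    by (intro distinct_concat) (auto simp: distinct_map inj_on_def dest: chunk_unique)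
  then show ?thesis
    using base_chunk vertex_chunk vertex_base vertex_base[symmetric] vertex_inj base_inj assms
    by (auto simp: route_def)
qed

lemma route_inter:
  assumes "i < m" "j < m" "i \<noteq> j" "u < n" "v < n" "u' < n" "v' < n"
    and q: "q \<in> set (route i u v)" "q \<in> set (route j u' v')"
  shows "q \<in> {vertex u, vertex v} \<and> q \<in> {vertex u', vertex v'}"
proof (cases "\<exists>k<n. q = vertex k")
  case True
  then show ?thesis using q vertex_in_route assms by blast
next
  case False
  then have nv: "q \<noteq> vertex u" "q \<noteq> vertex v" "q \<noteq> vertex u'" "q \<noteq> vertex v'" using assms by auto
  have False
    using q(1)
  proof (cases rule: set_route_cases)
    case (3 t)
    show False
      using q(2)
    proof (cases rule: set_route_cases)
      case (3 s)
      then show False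
        using \<open>t \<le> length ps\<close> \<open>q = base i t\<close> base_less_base[of i j t s] base_less_base[of j i s t] \<open>i \<noteq> j\<close> by force
    next
      case (4 s)
      then show False
        using set_chunk[of q j s] base_less_slot[OF \<open>i < m\<close> \<open>t \<le> length ps\<close>] \<open>q = base i t\<close> by (metis less_irrefl)
    qed (use nv in auto)
  next
    case (4 t)
    show False
      using q(2)
    proof (cases rule: set_route_cases)
      case (3 s)
      then show False
        using set_chunk[OF 4(2)] base_less_slot[OF \<open>j < m\<close> \<open>s \<le> length ps\<close>] by (metis less_irrefl)
    next
      case (4 s)
      have "s = t"
        using set_chunk[OF \<open>q \<in> set (chunk i t)\<close>] set_chunk[OF 4(2)] slot_less_slot[of s t] slot_less_slot[of t s]
        by (metis less_irrefl nat_neq_iff)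
      then show False
        using \<open>q \<in> set (chunk i t)\<close> 4(2) \<open>i \<noteq> j\<close> unfolding chunk_def
        by (auto simp: slot_def split: if_splits)
    qed (use nv in auto)
  qed (use nv in auto)
  then show ?thesis ..
qed

lemma pairsum_route:
  "pairsum h (route j u v) = h (vertex u) (base j 0)
     + (\<Sum>t<length ps. pairsum h (base j t # chunk j t @ [base j (Suc t)]))
     + h (base j (length ps)) (vertex v)"
proof -
  define C where "C = concat (map (\<lambda>t. base j t # chunk j t) [0..<length ps]) @ [base j (length ps)]"
  have C: "C \<noteq> []" "hd C = base j 0" "last C = base j (length ps)"
    by (cases "length ps"; simp add: C_def upt_conv_Cons del: upt_Suc)+
  have route: "route j u v = butlast [vertex u, base j 0] @ (butlast C @ [base j (length ps), vertex v])"
    by (simp add: route_def C_def)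
  have "pairsum h (butlast C @ [base j (length ps), vertex v]) = pairsum h C + h (base j (length ps)) (vertex v)"
    using C by (subst pairsum_join) auto
  moreover have "hd (butlast C @ [base j (length ps), vertex v]) = base j 0"
    by (cases "length ps") (simp_all add: C_def upt_conv_Cons del: upt_Suc)
  ultimately show ?thesis
    unfolding route by (subst pairsum_join) (auto simp: C_def pairsum_chunks)
qed

text \<open>On the ranks of route \<open>j\<close> the rows of slots 0 and 2 differ only at slot 1.
  Of the two segments that meet there, the one from the base point contributes 1; the one to slot 3
  contributes 0, since slot 3 exceeds slots 0 and 2.\<close>

lemma crossing_slots:
  assumes "t < length ps" "ps ! t = (i, j)" "j < m" "u < n" "v < n"
  shows "pairsum (crossing (slot t 0) (slot t 2)) (route j u v) = 1"
proof -
  define h where "h = crossing (slot t 0) (slot t 2)"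
  have "i \<noteq> j" using ps_ordered[of i j] assms nth_mem by fastforce
  have zero: "h b b' = 0"
    if "above (slot t 0) b = above (slot t 2) b" "above (slot t 0) b' = above (slot t 2) b'" for b b'
    using that by (simp add: h_def crossing_def)
  have low: "above (slot t c) (base j s) = 1" if "s \<le> length ps" for c s
    using base_less_slot[OF \<open>j < m\<close> that] by (simp add: above_def)
  have low_v: "above (slot t c) (vertex k) = 1" if "k < n" for c k
    using vertex_less_slot[OF that] by (simp add: above_def)
  have other: "pairsum h (base j s # chunk j s @ [base j (Suc s)]) = 0" if "s < length ps" "s \<noteq> t" for s
  proof -
    have "above (slot t 0) q = above (slot t 2) q" if "q \<in> set (chunk j s)" for q
      using set_chunk[OF that] slot_less_slot[of s t] slot_less_slot[of t s] \<open>s \<noteq> t\<close>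
      by (auto simp: above_def slot_def)
    then have "pairsum h (base j s # chunk j s @ [base j (Suc s)]) = pairsum (\<lambda>_ _. 0) (base j s # chunk j s @ [base j (Suc s)])"
      using low that by (intro pairsum_cong zero) auto
    then show ?thesis by (simp only: pairsum_zero)
  qed
  have own: "pairsum h (base j t # chunk j t @ [base j (Suc t)]) = 1"
  proof -
    have "chunk j t = [slot t 1, slot t 3]" using assms \<open>i \<noteq> j\<close> by (simp add: chunk_def)
    then show ?thesis
      using low assms by (simp add: h_def crossing_def) (simp add: above_def slot_def)
  qed
  have "(\<Sum>s<length ps. pairsum h (base j s # chunk j s @ [base j (Suc s)])) = (\<Sum>s<length ps. if s = t then 1 else 0)"
    using other own by (intro sum.cong) auto
  also have "\<dots> = 1" using assms by simp
  finally have "pairsum h (route j u v) = 1"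
    unfolding pairsum_route using zero low low_v assms by simp
  then show ?thesis by (simp add: h_def)
qed

text \<open>Every segment of route \<open>i\<close> other than the middle one of an excursion ends
  in a base point, which lies below the whole later route and gives a zero row. For a middle segment
  the rows are equal, unless the entry is \<open>(i, j)\<close> itself.\<close>

lemma crossings_route:
  assumes "i < j" "j < m" "u < n" "v < n" "u' < n" "v' < n"
  shows "crossings (route i u v) (route j u' v') = int (count_list ps (i, j))"
proof -
  define Q where "Q = route j u' v'"
  define inner where "inner x x' = pairsum (crossing x x') Q" for x x'
  have "i < m" using assms by simp
  have base_low: "base i t < q" if "q \<in> set Q" "t \<le> length ps" for q t
    using that(1) unfolding Q_def
  proof (cases rule: set_route_cases)
    case (3 s)
    then show ?thesis using base_less_base[OF \<open>i < j\<close> that(2)] by simp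
  next
    case (4 s)
    then show ?thesis using base_less_slot[OF \<open>i < m\<close> that(2)] set_chunk by fastforce
  qed (use base_less_vertex[OF \<open>i < m\<close> that(2)] in auto)
  have inner_base: "inner (base i t) x = 0" "inner x (base i t) = 0" if "t \<le> length ps" for x t
    unfolding inner_def using base_low that by (auto intro!: crossing_zero_row)
  have inner_chunk: "pairsum inner (base i t # chunk i t @ [base i (Suc t)]) = of_bool (ps ! t = (i, j))"
    if t: "t < length ps" for t
  proof -
    obtain a b where ab: "ps ! t = (a, b)" by fastforce
    have "a < b" using ps_ordered[of a b] nth_mem[OF t] ab by simp
    have same: "inner (slot t c) (slot t d) = 0" if "chunk j t = []" "c \<le> 3" "d \<le> 3" for c d
      unfolding inner_def
    proof (rule crossing_equal_rows)
      fix q assume "q \<in> set Q"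
      then show "above (slot t c) q = above (slot t d) q"
        unfolding Q_def
      proof (cases rule: set_route_cases)
        case (3 s)
        then show ?thesis using base_less_slot[OF \<open>j < m\<close>, of s t] by (simp add: above_def)
      next
        case (4 s)
        then have "s \<noteq> t" using that by auto
        then show ?thesis using set_chunk[OF 4(2)] slot_less_slot[of s t] slot_less_slot[of t s] that
          by (auto simp: above_def slot_def)
      qed (use assms vertex_less_slot in \<open>auto simp: above_def\<close>)
    qed
    consider "i = a" "j = b" | "i = a" "j \<noteq> b" | "i = b" | "i \<noteq> a" "i \<noteq> b" by blast
    then show ?thesis
    proof cases
      case 1
      then have ij: "ps ! t = (i, j)" using ab by simp
      then have "inner (slot t 0) (slot t 2) = 1"
        unfolding inner_def Q_def using crossing_slots[OF t _ \<open>j < m\<close>] assms by simp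
      then show ?thesis using ij t by (simp add: chunk_def inner_base)
    next
      case 2
      then have ij: "ps ! t = (i, b)" "j \<noteq> b" using ab by auto
      then have "chunk j t = []" using \<open>i < j\<close> by (simp add: chunk_def)
      then show ?thesis using ij t same[of 0 2] by (simp add: chunk_def[of i] inner_base)
    next
      case 3
      then have ij: "ps ! t = (a, i)" "a < i" using ab \<open>a < b\<close> by auto
      then have "chunk j t = []" using \<open>i < j\<close> by (simp add: chunk_def)
      then show ?thesis using ij t same[of 1 3] \<open>i < j\<close> by (simp add: chunk_def[of i] inner_base)
    next
      case 4
      then show ?thesis using ab t by (simp add: chunk_def inner_base)
    qed
  qed
  have "crossings (route i u v) Q = pairsum inner (route i u v)"
    by (simp add: crossings_def inner_def[abs_def])
  also have "\<dots> = (\<Sum>t<length ps. of_bool (ps ! t = (i, j)))"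
    unfolding pairsum_route using inner_base inner_chunk by simp
  also have "\<dots> = int (count_list ps (i, j))"
    by (auto simp: count_list_eq_length_filter length_filter_conv_card sum_of_bool_eq
        intro!: arg_cong[where f = card])
  finally show ?thesis by (simp add: Q_def)
qed

end

lemma exists_list_with_counts:
  assumes "finite S"
  shows "\<exists>xs. \<forall>x. count_list xs x = (if x \<in> S then N x else 0)"
  using assms
proof (induction S)
  case empty
  show ?case by (intro exI[of _ "[]"]) simp
next
  case (insert y S)
  then obtain xs where xs: "\<And>x. count_list xs x = (if x \<in> S then N x else 0)" by blast
  have "count_list (replicate k y) x = (if x = y then k else 0)" for k x
    by (induction k) auto
  then show ?case using xs insert by (intro exI[of _ "replicate (N y) y @ xs"]) auto
qed

section \<open>Graphs routed along the moment curve\<close>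

lemma pathstart_polyline: "ps \<noteq> [] \<Longrightarrow> pathstart (polyline ps) = hd ps"
  by (induction ps rule: polyline.induct) simp_all

lemma path_image_polyline:
  "2 \<le> length ps \<Longrightarrow> path_image (polyline ps) = (\<Union>(p, q)\<in>set (zip ps (tl ps)). closed_segment p q)"
  by (induction ps rule: polyline.induct) (simp_all add: path_image_join pathstart_polyline)

lemma path_image_polyline_node:
  "2 \<le> length ks \<Longrightarrow> path_image (polyline (map node ks)) =
    (\<Union>(a, b)\<in>set (zip ks (tl ks)). closed_segment (node a) (node b))"
  by (subst path_image_polyline) (auto simp: zip_map_map simp flip: map_tl)

text \<open>The last fact excludes the segment between the two ends, which parallel edges could
  otherwise share.\<close>

lemma set_zip_tl:
  assumes "distinct ks" "(a, b) \<in> set (zip ks (tl ks))"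
  shows "a \<in> set ks" "b \<in> set ks" "a \<noteq> b" "3 \<le> length ks \<Longrightarrow> {a, b} \<noteq> {hd ks, last ks}"
proof -
  obtain i where i: "Suc i < length ks" "a = ks ! i" "b = ks ! Suc i"
    using assms(2) by (auto simp: set_zip nth_tl less_diff_conv)
  then show "a \<in> set ks" "b \<in> set ks" "a \<noteq> b"
    using assms(1) by (auto simp: nth_eq_iff_index_eq)
  have "ks \<noteq> []" using i by auto
  then have "hd ks = ks ! 0" "last ks = ks ! (length ks - 1)"
    by (auto simp: hd_conv_nth last_conv_nth)
  then show "{a, b} \<noteq> {hd ks, last ks}" if "3 \<le> length ks"
  proof -
    have "0 < length ks" "length ks - 1 < length ks" using i by auto
    then have "ks ! i = ks ! (length ks - 1) \<longleftrightarrow> i = length ks - 1" "ks ! Suc i = ks ! 0 \<longleftrightarrow> Suc i = 0"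
      "ks ! i = ks ! 0 \<longleftrightarrow> i = 0" "ks ! Suc i = ks ! (length ks - 1) \<longleftrightarrow> Suc i = length ks - 1"
      using i assms(1) by (auto simp: nth_eq_iff_index_eq simp del: nth_Cons_0)
    then show ?thesis
      unfolding \<open>hd ks = _\<close> \<open>last ks = _\<close> i doubleton_eq_iff using that i(1) by linarith
  qed
qed

lemma arc_polyline_node:
  "distinct ks \<Longrightarrow> 2 \<le> length ks \<Longrightarrow> arc (polyline (map node ks))"
proof (induction ks rule: induct_list012)
  case (3 x y zs)
  show ?case
  proof (cases zs)
    case Nil
    then show ?thesis using 3 by (simp add: arc_linepath)
  next
    case (Cons z zs')
    let ?rest = "polyline (map node (y # zs))"
    have "path_image (linepath (node x) (node y)) \<inter> path_image ?rest \<subseteq> {node y}"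
    proof -
      have "closed_segment (node x) (node y) \<inter> closed_segment (node a) (node b) \<subseteq> {node y}"
        if ab: "(a, b) \<in> set (zip (y # zs) (tl (y # zs)))" for a b
      proof -
        have "a \<in> set (y # zs)" "b \<in> set (y # zs)" "a \<noteq> b"
          using set_zip_tl(1-3)[OF _ ab] 3(3) by auto
        then have "x \<notin> {a, b}" "a \<noteq> b" "x \<noteq> y" using 3(3) by auto
        then show ?thesis
          using node_segments_inter[of x y a b] by auto
      qed
      then show ?thesis
        unfolding path_image_linepath using Cons by (subst path_image_polyline_node) auto
    qed
    then have "arc (linepath (node x) (node y) +++ ?rest)"
      using 3 Cons by (intro arc_join) (auto simp: arc_linepath pathstart_polyline)
    then show ?thesis using Cons by simp
  qed
qed auto

text \<open>Otherwise the segments from \<open>k\<close> to \<open>a\<close> and from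
  \<open>a\<close> to \<open>b\<close> would meet at most in the node of \<open>a\<close>, although
  both contain the node of \<open>k\<close>.\<close>

lemma node_in_segment:
  assumes "a \<noteq> b" "node k \<in> closed_segment (node a) (node b)"
  shows "k \<in> {a, b}"
proof (rule ccontr)
  assume k: "k \<notin> {a, b}"
  then have "closed_segment (node k) (node a) \<inter> closed_segment (node a) (node b) \<subseteq> node ` ({k, a} \<inter> {a, b})"
    using assms by (intro node_segments_inter) (auto simp: doubleton_eq_iff)
  then have "node k \<in> node ` ({k, a} \<inter> {a, b})" using assms by (auto 0 3)
  then show False using k by auto
qed

text \<open>A cycle lists its edges together with their starting vertices, while the power sums run
  over edges. The vertex \<open>g y\<close> is chosen once for all summands
  \<open>F\<close>.\<close>

lemma sum_list_zip_distinct: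
  assumes "length xs = length ys" "distinct ys" "distinct xs"
  shows "\<exists>g. \<forall>F. (\<Sum>(x, y)\<leftarrow>zip xs ys. F x y) = (\<Sum>y\<in>set ys. (F (g y) y :: int))"
proof -
  define g where "g y = (THE x. (x, y) \<in> set (zip xs ys))" for y
  have g: "g y = x" if "(x, y) \<in> set (zip xs ys)" for x y
    unfolding g_def
  proof (rule the_equality)
    show "(x, y) \<in> set (zip xs ys)" by (rule that)
    fix z assume "(z, y) \<in> set (zip xs ys)"
    then show "z = x" using that assms by (auto simp: set_zip nth_eq_iff_index_eq)
  qed
  have "(\<Sum>(x, y)\<leftarrow>zip xs ys. F x y) = (\<Sum>y\<in>set ys. F (g y) y)" for F :: "'a \<Rightarrow> 'b \<Rightarrow> int"
  proof -
    have "(\<Sum>(x, y)\<leftarrow>zip xs ys. F x y) = (\<Sum>p\<leftarrow>zip xs ys. F (g (snd p)) (snd p))"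
      using g by (intro arg_cong[where f = sum_list] map_cong refl) auto
    also have "\<dots> = (\<Sum>y\<leftarrow>map snd (zip xs ys). F (g y) y)"
      by (simp add: o_def)
    also have "\<dots> = (\<Sum>y\<leftarrow>ys. F (g y) y)"
      using assms(1) by simp
    also have "\<dots> = (\<Sum>y\<in>set ys. F (g y) y)"
      using assms(2) by (simp add: sum.distinct_set_conv_list)
    finally show ?thesis .
  qed
  then show ?thesis by blast
qed

text \<open>\<open>L1 @ [hd L1]\<close> turns cyclic neighbours into consecutive entries. The
  parameters drop out because \<open>crossing\<close> depends only on the order.\<close>

lemma crossing_sum_vertical:
  assumes L1: "distinct L1" "3 \<le> length L1" and L2: "distinct L2" "3 \<le> length L2"
    and disj: "set L1 \<inter> set L2 = {}"
  shows "crossing_sum vertical_frame (map node L1) (map node L2)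
    = - crossings (L1 @ [hd L1]) (L2 @ [hd L2])"
    and "\<And>s t. s \<in> sides (map node L1) \<Longrightarrow> t \<in> sides (map node L2) \<Longrightarrow> side_det s t \<noteq> 0"
proof -
  have four: "distinct [param a, param a', param b, param b']"
    if "(a, a') \<in> set (zip L1 (rotate1 L1))" "(b, b') \<in> set (zip L2 (rotate1 L2))" for a a' b b'
  proof -
    have "a \<in> set L1" "a' \<in> set L1" "b \<in> set L2" "b' \<in> set L2"
      using that by (metis set_zip_leftD set_zip_rightD set_rotate1)+
    then show ?thesis
      using cyclic_pairs(1)[OF L1 that(1)] cyclic_pairs(1)[OF L2 that(2)] disj by auto
  qed
  show det: "side_det s t \<noteq> 0" if "s \<in> sides (map node L1)" "t \<in> sides (map node L2)" for s t
    using that signed_hit_moment(1)[OF four] unfolding sides_map by (auto simp: node_def)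
  have pairs: "zip L (rotate1 L) = zip (L @ [hd L]) (tl (L @ [hd L]))" if "3 \<le> length L" for L :: "nat list"
  proof -
    have "L \<noteq> []" using that by auto
    then have "tl (L @ [hd L]) = rotate1 L" by (cases L) auto
    then show ?thesis by (simp add: zip_append1)
  qed
  have inj: "inj_on (map_prod node node) A" for A
    using inj_node by (auto simp: inj_on_def)
  have "real_of_int (crossing_sum vertical_frame (map node L1) (map node L2))
    = (\<Sum>s\<in>sides (map node L1). \<Sum>t\<in>sides (map node L2). signed_hit (axis 3 1) s t)"
    using crossing_sum_eq_signed_hits[OF orthonormal_vertical_frame det] by (simp add: cross_vertical_frame)
  also have "\<dots> = (\<Sum>(a, a')\<in>set (zip L1 (rotate1 L1)). \<Sum>(b, b')\<in>set (zip L2 (rotate1 L2)). - real_of_int (crossing a a' b b'))"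
    unfolding sides_map using four
    by (auto simp: sum.reindex[OF inj] node_def signed_hit_moment(2) crossing_strict_mono[OF strict_mono_param]
        intro!: sum.cong)
  also have "\<dots> = - real_of_int (\<Sum>(a, a')\<in>set (zip L1 (rotate1 L1)). \<Sum>(b, b')\<in>set (zip L2 (rotate1 L2)). crossing a a' b b')"
    by (simp add: sum_negf case_prod_unfold)
  also have "(\<Sum>(a, a')\<in>set (zip L1 (rotate1 L1)). \<Sum>(b, b')\<in>set (zip L2 (rotate1 L2)). crossing a a' b b')
    = crossings (L1 @ [hd L1]) (L2 @ [hd L2])"
    using L1 L2 by (simp add: crossings_def pairsum_zip pairs[symmetric] sum.distinct_set_conv_list distinct_zipI1 case_prod_unfold)
  finally show "crossing_sum vertical_frame (map node L1) (map node L2) = - crossings (L1 @ [hd L1]) (L2 @ [hd L2])"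
    by simp
qed

text \<open>The interface between the gadgets and the geometry. \<open>trail_ends\<close> leaves
  open at which end of \<open>e\<close> its trail starts, which is the source of the signs
  \<open>direction\<close>.\<close>

locale routed_graph =
  fixes V :: "'v set" and E :: "'e set" and ends :: "'e \<Rightarrow> 'v set"
    and rank :: "'v \<Rightarrow> nat" and trail :: "'e \<Rightarrow> nat list"
  assumes graph: "finite_graph V E ends"
    and inj_rank: "inj_on rank V"
    and distinct_trail: "e \<in> E \<Longrightarrow> distinct (trail e)"
    and length_trail: "e \<in> E \<Longrightarrow> 3 \<le> length (trail e)"
    and trail_ends: "e \<in> E \<Longrightarrow> {hd (trail e), last (trail e)} = rank ` ends e"
    and trail_inter: "e \<in> E \<Longrightarrow> e' \<in> E \<Longrightarrow> e \<noteq> e' \<Longrightarrow> set (trail e) \<inter> set (trail e') \<subseteq> rank ` ends e \<inter> rank ` ends e'"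
    and rank_in_trail: "v \<in> V \<Longrightarrow> e \<in> E \<Longrightarrow> rank v \<in> set (trail e) \<Longrightarrow> v \<in> ends e"
begin

lemma embedding: "graph_embedding V E ends (node \<circ> rank) (map node \<circ> trail)"
proof -
  have img: "path_image (polyline (map node (trail e))) =
      (\<Union>(a, b)\<in>set (zip (trail e) (tl (trail e))). closed_segment (node a) (node b))" if "e \<in> E" for e
    using length_trail[OF that] by (intro path_image_polyline_node) simp
  have ne: "trail e \<noteq> []" if "e \<in> E" for e using length_trail[OF that] by auto
  have hd_last: "{hd (map node (trail e)), last (map node (trail e))} = node ` rank ` ends e" if "e \<in> E" for e
    using trail_ends[OF that, symmetric] ne[OF that] by (simp add: hd_map last_map)
  have disj: "path_image (polyline (map node (trail e))) \<inter> polyline_interior (map node (trail e')) = {}"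
    if e: "e \<in> E" "e' \<in> E" "e \<noteq> e'" for e e'
  proof -
    have "z \<in> node ` rank ` ends e'"
      if z: "z \<in> path_image (polyline (map node (trail e)))" "z \<in> path_image (polyline (map node (trail e')))" for z
    proof -
      obtain a b where ab: "(a, b) \<in> set (zip (trail e) (tl (trail e)))" "z \<in> closed_segment (node a) (node b)"
        using z(1) img[OF e(1)] by auto
      obtain c d where cd: "(c, d) \<in> set (zip (trail e') (tl (trail e')))" "z \<in> closed_segment (node c) (node d)"
        using z(2) img[OF e(2)] by auto
      note ab' = set_zip_tl[OF distinct_trail[OF e(1)] ab(1)]
      note cd' = set_zip_tl[OF distinct_trail[OF e(2)] cd(1)]
      have sub: "{a, b} \<inter> {c, d} \<subseteq> rank ` ends e \<inter> rank ` ends e'"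
        using trail_inter[OF e] ab'(1,2) cd'(1,2) by blast
      have "{a, b} \<noteq> {c, d}"
      proof
        \<comment> \<open>A segment shared by two trails would join two common vertices, hence the
          two ends of \<open>e\<close>; but a trail has a further point between its ends.\<close>
        assume eq: "{a, b} = {c, d}"
        then have "{a, b} \<subseteq> {hd (trail e), last (trail e)}" using sub trail_ends[OF e(1)] by simp
        then have "{a, b} = {hd (trail e), last (trail e)}" using ab'(3) by auto
        then show False using ab'(4)[OF length_trail[OF e(1)]] by simp
      qed
      then have "z \<in> node ` ({a, b} \<inter> {c, d})"
        using node_segments_inter[OF ab'(3) cd'(3)] ab cd by blast
      then show ?thesis using sub by blast
    qed
    then show ?thesis unfolding polyline_interior_def hd_last[OF e(2)] by blast
  qed
  have vert: "node (rank v) \<notin> polyline_interior (map node (trail e))" if v: "v \<in> V" "e \<in> E" for v e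
  proof
    assume "node (rank v) \<in> polyline_interior (map node (trail e))"
    then have "node (rank v) \<in> path_image (polyline (map node (trail e)))" and out: "node (rank v) \<notin> node ` rank ` ends e"
      unfolding polyline_interior_def hd_last[OF v(2)] by auto
    then obtain a b where ab: "(a, b) \<in> set (zip (trail e) (tl (trail e)))" "node (rank v) \<in> closed_segment (node a) (node b)"
      using img[OF v(2)] by auto
    note ab' = set_zip_tl[OF distinct_trail[OF v(2)] ab(1)]
    have "rank v \<in> set (trail e)" using node_in_segment[OF ab'(3) ab(2)] ab' by auto
    then show False using rank_in_trail[OF v] out by blast
  qed
  show ?thesis
    unfolding graph_embedding_def
  proof (intro conjI ballI impI)
    show "inj_on (node \<circ> rank) V"
      using inj_rank by (simp add: inj_on_def)
    fix e assume e: "e \<in> E"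
    show "arc (polyline ((map node \<circ> trail) e))"
      using distinct_trail[OF e] length_trail[OF e] by (simp add: arc_polyline_node)
    show "{hd ((map node \<circ> trail) e), last ((map node \<circ> trail) e)} = (node \<circ> rank) ` ends e"
      using hd_last[OF e] by (simp add: image_comp)
  qed (use disj vert in auto)
qed

definition oriented :: "'v \<Rightarrow> 'e \<Rightarrow> nat list" where
  "oriented v e = (if hd (trail e) = rank v then trail e else rev (trail e))"

lemma line_from_oriented:
  assumes "e \<in> E"
  shows "line_from (node \<circ> rank) (map node \<circ> trail) v e = map node (oriented v e)"
proof -
  have "trail e \<noteq> []" using length_trail[OF assms] by auto
  then show ?thesis by (simp add: line_from_def oriented_def hd_map rev_map)
qed

lemma oriented_facts:
  assumes "e \<in> E" "ends e = {v, w}"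
  shows "distinct (oriented v e)" "set (oriented v e) = set (trail e)" "3 \<le> length (oriented v e)"
    "hd (oriented v e) = rank v" "last (oriented v e) = rank w"
proof -
  have ne: "trail e \<noteq> []" using length_trail[OF assms(1)] by auto
  show "distinct (oriented v e)" "set (oriented v e) = set (trail e)" "3 \<le> length (oriented v e)"
    using distinct_trail[OF assms(1)] length_trail[OF assms(1)] by (auto simp: oriented_def)
  have eq: "{hd (trail e), last (trail e)} = {rank v, rank w}"
    using trail_ends[OF assms(1)] assms(2) by simp
  then consider "hd (trail e) = rank v" "last (trail e) = rank w" | "hd (trail e) = rank w" "last (trail e) = rank v"
    by (metis doubleton_eq_iff)
  then show "hd (oriented v e) = rank v" "last (oriented v e) = rank w"
    by (cases; simp add: oriented_def hd_rev last_rev)+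
qed

definition direction :: "'v \<Rightarrow> 'e \<Rightarrow> int" where
  "direction v e = (if hd (trail e) = rank v then 1 else - 1)"

lemma crossings_oriented:
  "crossings (oriented v e) (oriented v' e') = direction v e * direction v' e' * crossings (trail e) (trail e')"
  by (simp add: oriented_def direction_def crossings_rev_left crossings_rev_right)

definition closed_trail :: "'v list \<Rightarrow> 'e list \<Rightarrow> nat list" where
  "closed_trail vs es = concat (map2 (\<lambda>v e. butlast (oriented v e)) vs es)"

lemma triangle_cases:
  assumes "graph_cycle V E ends vs es" "length vs = 3"
  obtains v0 v1 v2 e0 e1 e2 where "vs = [v0, v1, v2]" "es = [e0, e1, e2]"
    "distinct [v0, v1, v2]" "distinct [e0, e1, e2]" "{v0, v1, v2} \<subseteq> V" "{e0, e1, e2} \<subseteq> E"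
    "ends e0 = {v0, v1}" "ends e1 = {v1, v2}" "ends e2 = {v2, v0}"
proof -
  obtain v0 v1 v2 where vs: "vs = [v0, v1, v2]"
    using assms(2) by (auto simp: length_Suc_conv numeral_3_eq_3)
  have "length es = 3" using assms by (simp add: graph_cycle_def)
  then obtain e0 e1 e2 where es: "es = [e0, e1, e2]"
    by (auto simp: length_Suc_conv numeral_3_eq_3)
  have *: "ends (es ! i) = {vs ! i, vs ! (Suc i mod 3)}" if "i < 3" for i
    using assms that by (simp add: graph_cycle_def)
  have "ends e0 = {v0, v1}" "ends e1 = {v1, v2}" "ends e2 = {v2, v0}"
    using *[of 0] *[of 1] *[of 2] by (simp_all add: vs es)
  moreover have "distinct vs" "distinct es" "set vs \<subseteq> V" "set es \<subseteq> E"
    using assms(1) unfolding graph_cycle_def by blast+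
  ultimately show thesis
    using that[OF vs es] unfolding vs es by simp
qed

lemma cycle_image_closed_trail:
  assumes "graph_cycle V E ends vs es"
  shows "cycle_image (node \<circ> rank) (map node \<circ> trail) vs es = map node (closed_trail vs es)"
proof -
  have "map2 (\<lambda>v e. butlast (line_from (node \<circ> rank) (map node \<circ> trail) v e)) vs es
    = map2 (\<lambda>v e. map node (butlast (oriented v e))) vs es"
    using assms
    by (intro map_cong refl) (auto simp: graph_cycle_def line_from_oriented map_butlast dest!: set_zip_rightD)
  then show ?thesis
    unfolding cycle_image_def closed_trail_def map_concat
    by (simp only: map_map o_def case_prod_unfold)
qed

text \<open>\<open>butlast\<close> drops the vertex with which the next trail begins. Repeating the
  first entry at the end restores the end of the last trail, so the consecutive pairs are exactly
  those of the three open trails.\<close>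

lemma closed_trail_facts:
  assumes "graph_cycle V E ends vs es" "length vs = 3"
  shows "distinct (closed_trail vs es)" "3 \<le> length (closed_trail vs es)" "set (closed_trail vs es) \<subseteq> (\<Union>e\<in>set es. set (trail e))"
    "pairsum h (closed_trail vs es @ [hd (closed_trail vs es)]) = (\<Sum>(v, e)\<leftarrow>zip vs es. pairsum h (oriented v e))"
proof -
  obtain v0 v1 v2 e0 e1 e2 where vs: "vs = [v0, v1, v2]" and es: "es = [e0, e1, e2]"
    and d: "distinct [v0, v1, v2]" "distinct [e0, e1, e2]" and V: "{v0, v1, v2} \<subseteq> V" and E: "{e0, e1, e2} \<subseteq> E"
    and ends: "ends e0 = {v0, v1}" "ends e1 = {v1, v2}" "ends e2 = {v2, v0}"
    using triangle_cases[OF assms] by blast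
  define A where "A = oriented v0 e0"
  define B where "B = oriented v1 e1"
  define C where "C = oriented v2 e2"
  have A: "distinct A" "set A = set (trail e0)" "3 \<le> length A" "hd A = rank v0" "last A = rank v1"
    using oriented_facts[of e0 v0 v1] E ends by (auto simp: A_def)
  have B: "distinct B" "set B = set (trail e1)" "3 \<le> length B" "hd B = rank v1" "last B = rank v2"
    using oriented_facts[of e1 v1 v2] E ends by (auto simp: B_def)
  have C: "distinct C" "set C = set (trail e2)" "3 \<le> length C" "hd C = rank v2" "last C = rank v0"
    using oriented_facts[of e2 v2 v0] E ends by (auto simp: C_def)
  have ne: "A \<noteq> []" "B \<noteq> []" "C \<noteq> []" using A(3) B(3) C(3) by auto
  have closed_trail: "closed_trail vs es = butlast A @ butlast B @ butlast C"
    by (simp add: closed_trail_def vs es A_def B_def C_def)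
  have rank: "rank v0 \<noteq> rank v1" "rank v1 \<noteq> rank v2" "rank v0 \<noteq> rank v2"
    using inj_rank V d by (auto simp: inj_on_def)
  have last_notin: "last xs \<notin> set (butlast xs)" if "distinct xs" "xs \<noteq> []" for xs :: "nat list"
    using that by (metis append_butlast_last_id distinct_append disjoint_iff list.set_intros(1))
  have AB: "set A \<inter> set B \<subseteq> {rank v1}" and AC: "set A \<inter> set C \<subseteq> {rank v0}" and BC: "set B \<inter> set C \<subseteq> {rank v2}"
    using trail_inter[of e0 e1] trail_inter[of e0 e2] trail_inter[of e1 e2] E d rank
    unfolding A(2) B(2) C(2) ends by auto
  have disj: "set (butlast A) \<inter> set (butlast B) = {}" "set (butlast A) \<inter> set (butlast C) = {}" "set (butlast B) \<inter> set (butlast C) = {}"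
    using AB AC BC last_notin[OF A(1) ne(1)] last_notin[OF B(1) ne(2)] last_notin[OF C(1) ne(3)]
      in_set_butlastD[of _ A] in_set_butlastD[of _ B] in_set_butlastD[of _ C]
    unfolding A(5) B(5) C(5) by blast+
  show "distinct (closed_trail vs es)"
    unfolding closed_trail using A(1) B(1) C(1) disj by (auto simp: distinct_butlast)
  show "3 \<le> length (closed_trail vs es)"
    unfolding closed_trail length_append length_butlast using A(3) B(3) C(3) by linarith
  show "set (closed_trail vs es) \<subseteq> (\<Union>e\<in>set es. set (trail e))"
    unfolding closed_trail using A(2) B(2) C(2) by (auto simp: es dest!: in_set_butlastD)
  have nb: "butlast A \<noteq> []" "butlast B \<noteq> []" "butlast C \<noteq> []"
    using A(3) B(3) C(3) by (auto simp: butlast_conv_take)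
  have hd_butlast: "hd (butlast xs) = hd xs" if "butlast xs \<noteq> []" for xs :: "nat list"
    using that by (cases xs) auto
  have "hd (closed_trail vs es) = last C"
    unfolding closed_trail using nb hd_butlast A(4) C(5) by simp
  then have closed: "closed_trail vs es @ [hd (closed_trail vs es)] = butlast A @ butlast B @ C"
    unfolding closed_trail using ne by simp
  have "hd (butlast B @ C) = rank v1" using nb hd_butlast B(4) by simp
  then have "pairsum h (closed_trail vs es @ [hd (closed_trail vs es)]) = pairsum h A + (pairsum h B + pairsum h C)"
    unfolding closed using ne A B C by (simp add: pairsum_join)
  then show "pairsum h (closed_trail vs es @ [hd (closed_trail vs es)]) = (\<Sum>(v, e)\<leftarrow>zip vs es. pairsum h (oriented v e))"
    by (simp add: vs es A_def B_def C_def)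
qed


lemma closed_trail_disjoint:
  assumes "graph_cycle V E ends vs1 es1" "length vs1 = 3"
    and "graph_cycle V E ends vs2 es2" "length vs2 = 3"
    and "set vs1 \<inter> set vs2 = {}"
  shows "\<And>e e'. e \<in> set es1 \<Longrightarrow> e' \<in> set es2 \<Longrightarrow> e \<noteq> e' \<and> set (trail e) \<inter> set (trail e') = {}"
    and "set (closed_trail vs1 es1) \<inter> set (closed_trail vs2 es2) = {}"
proof -
  have ends: "ends e \<subseteq> set vs" "ends e \<noteq> {}" "ends e \<subseteq> V" "e \<in> E"
    if c: "graph_cycle V E ends vs es" "length vs = 3" "e \<in> set es" for vs es e
  proof -
    obtain v0 v1 v2 e0 e1 e2 where t: "vs = [v0, v1, v2]" "es = [e0, e1, e2]"
      "{v0, v1, v2} \<subseteq> V" "{e0, e1, e2} \<subseteq> E"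
      "ends e0 = {v0, v1}" "ends e1 = {v1, v2}" "ends e2 = {v2, v0}"
      using triangle_cases[OF c(1,2)] by metis
    consider "e = e0" | "e = e1" | "e = e2" using c(3) t(2) by auto
    then show "ends e \<subseteq> set vs" "ends e \<noteq> {}" "ends e \<subseteq> V" "e \<in> E"
      using t by (cases; simp)+
  qed
  show disj: "e \<noteq> e' \<and> set (trail e) \<inter> set (trail e') = {}" if e: "e \<in> set es1" "e' \<in> set es2" for e e'
  proof -
    note e1 = ends[OF assms(1,2) e(1)] and e2 = ends[OF assms(3,4) e(2)]
    have "e \<noteq> e'" using e1 e2 assms(5) by blast
    moreover have "rank ` ends e \<inter> rank ` ends e' = rank ` (ends e \<inter> ends e')"
      using inj_on_image_Int[OF inj_rank e1(3) e2(3)] by simp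
    moreover have "ends e \<inter> ends e' = {}" using e1(1) e2(1) assms(5) by blast
    ultimately show ?thesis using trail_inter[OF e1(4) e2(4)] by simp
  qed
  show "set (closed_trail vs1 es1) \<inter> set (closed_trail vs2 es2) = {}"
    using closed_trail_facts(3)[OF assms(1,2)] closed_trail_facts(3)[OF assms(3,4)] disj by blast
qed

text \<open>\<open>crossings\<close> is additive over the trails in both arguments, and reversing a
  trail changes its sign. The vertices \<open>g1 e\<close> and \<open>g2 e'\<close> enter through
  these signs only.\<close>

lemma linking_number_cycles:
  assumes "graph_cycle V E ends vs1 es1" "length vs1 = 3"
    and "graph_cycle V E ends vs2 es2" "length vs2 = 3"
    and "set vs1 \<inter> set vs2 = {}"
  shows "\<exists>g1 g2. linking_number (cycle_image (node \<circ> rank) (map node \<circ> trail) vs1 es1) (cycle_image (node \<circ> rank) (map node \<circ> trail) vs2 es2)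
    = - (\<Sum>e\<in>set es1. \<Sum>e'\<in>set es2. direction (g1 e) e * direction (g2 e') e' * crossings (trail e) (trail e'))"
proof -
  define L1 where "L1 = closed_trail vs1 es1"
  define L2 where "L2 = closed_trail vs2 es2"
  note r1 = closed_trail_facts[OF assms(1,2), folded L1_def] and r2 = closed_trail_facts[OF assms(3,4), folded L2_def]
  have disj: "set L1 \<inter> set L2 = {}"
    using closed_trail_disjoint(2)[OF assms] by (simp add: L1_def L2_def)
  note gen = generic_projection_vertical[OF r1(1,2) r2(1,2) disj]
  note vert = crossing_sum_vertical[OF r1(1,2) r2(1,2) disj]
  have "linking_number (map node L1) (map node L2) = crossing_sum vertical_frame (map node L1) (map node L2)"
    unfolding linking_number_def
  proof (rule crossing_sum_independent)
    \<comment> \<open>The vertical frame is generic, so a generic frame exists and the one chosen by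
      \<open>SOME\<close> is generic as well.\<close>
    show "generic_projection (SOME F. generic_projection F (map node L1) (map node L2)) (map node L1) (map node L2)"
      using gen by (rule someI)
    show "distinct (map node L1)" "distinct (map node L2)"
      using r1 r2 inj_on_subset[OF inj_node] by (auto simp: distinct_map)
    show "set (map node L1) \<inter> set (map node L2) = {}" using disj by auto
  qed (use gen vert(2) in auto)
  also have "\<dots> = - crossings (L1 @ [hd L1]) (L2 @ [hd L2])" by (rule vert(1))
  also have "crossings (L1 @ [hd L1]) (L2 @ [hd L2])
     = (\<Sum>(v, e)\<leftarrow>zip vs1 es1. \<Sum>(v', e')\<leftarrow>zip vs2 es2. crossings (oriented v e) (oriented v' e'))"
  proof -
    have zero: "pairsum (\<lambda>x y. (\<Sum>p\<leftarrow>ps. f p x y)) xs = (\<Sum>p\<leftarrow>ps. pairsum (f p) xs)"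
      for f :: "'v \<times> 'e \<Rightarrow> nat \<Rightarrow> nat \<Rightarrow> int" and ps xs
      by (induction ps) (simp_all add: pairsum_zero pairsum_add)
    have "crossings (L1 @ [hd L1]) (L2 @ [hd L2])
      = (\<Sum>(v, e)\<leftarrow>zip vs1 es1. pairsum (\<lambda>a a'. pairsum (crossing a a') (L2 @ [hd L2])) (oriented v e))"
      unfolding crossings_def by (rule r1(4))
    then show ?thesis
      unfolding r2(4) case_prod_unfold zero crossings_def .
  qed
  finally have main: "linking_number (map node L1) (map node L2)
    = - (\<Sum>(v, e)\<leftarrow>zip vs1 es1. \<Sum>(v', e')\<leftarrow>zip vs2 es2. direction v e * direction v' e' * crossings (trail e) (trail e'))"
    by (simp add: crossings_oriented)
  have lens: "length vs1 = length es1" "distinct es1" "distinct vs1" "length vs2 = length es2" "distinct es2" "distinct vs2"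
    using assms by (auto simp: graph_cycle_def)
  obtain g1 where g1: "\<And>F. (\<Sum>(x, y)\<leftarrow>zip vs1 es1. F x y) = (\<Sum>y\<in>set es1. (F (g1 y) y :: int))"
    using sum_list_zip_distinct[OF lens(1-3)] by blast
  obtain g2 where g2: "\<And>F. (\<Sum>(x, y)\<leftarrow>zip vs2 es2. F x y) = (\<Sum>y\<in>set es2. (F (g2 y) y :: int))"
    using sum_list_zip_distinct[OF lens(4-6)] by blast
  show ?thesis
    unfolding cycle_image_closed_trail[OF assms(1)] cycle_image_closed_trail[OF assms(3)] L1_def[symmetric] L2_def[symmetric] main g1 g2
    by blast
qed

end

text \<open>The signed sum of the powers is a non-zero integer, so \<open>K\<close> times it has
  absolute value at least \<open>K\<close>, while all deviations together stay below
  \<open>K\<close>.\<close>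

lemma perturbed_power_sum:
  assumes fin: "finite A" "A \<noteq> {}" and inj: "inj_on key A"
    and sign: "\<And>p. p \<in> A \<Longrightarrow> \<bar>\<epsilon> p\<bar> = (1::int)"
    and close: "\<And>p. p \<in> A \<Longrightarrow> \<bar>c p - K * 2 ^ key p\<bar> \<le> d"
    and K: "d * int (card A) < K"
  shows "(\<Sum>p\<in>A. \<epsilon> p * c p) \<noteq> 0"
proof
  define S where "S = (\<Sum>p\<in>A. \<epsilon> p * 2 ^ key p)"
  define \<delta> where "\<delta> b = \<epsilon> (the_inv_into A key b)" for b
  have "S = (\<Sum>b\<in>key ` A. \<delta> b * 2 ^ b)"
    unfolding S_def \<delta>_def using inj by (simp add: sum.reindex the_inv_into_f_f)
  also have "\<dots> \<noteq> 0"
    using fin sign inj by (intro signed_powers_of_two) (auto simp: \<delta>_def the_inv_into_f_f)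
  finally have "1 \<le> \<bar>S\<bar>" by simp
  have "\<bar>\<Sum>p\<in>A. \<epsilon> p * (c p - K * 2 ^ key p)\<bar> \<le> (\<Sum>p\<in>A. \<bar>\<epsilon> p * (c p - K * 2 ^ key p)\<bar>)"
    by (rule sum_abs)
  also have "\<dots> \<le> (\<Sum>p\<in>A. d)"
    using sign close by (intro sum_mono) (simp add: abs_mult)
  also have "\<dots> < K" using K by (simp add: mult.commute)
  finally have small: "\<bar>\<Sum>p\<in>A. \<epsilon> p * (c p - K * 2 ^ key p)\<bar> < K" .
  have "(\<Sum>p\<in>A. \<epsilon> p * (c p - K * 2 ^ key p)) = (\<Sum>p\<in>A. \<epsilon> p * c p) - K * S"
    unfolding S_def sum_distrib_left sum_subtractf[symmetric] by (intro sum.cong) (auto simp: algebra_simps)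
  moreover assume "(\<Sum>p\<in>A. \<epsilon> p * c p) = 0"
  ultimately have "\<bar>K * S\<bar> < K" using small by simp
  moreover have "0 \<le> K" using small by linarith
  ultimately have "K * \<bar>S\<bar> < K * 1" by (simp add: abs_mult)
  then show False using \<open>1 \<le> \<bar>S\<bar>\<close> \<open>0 \<le> K\<close> mult_left_mono[of 1 "\<bar>S\<bar>" K] by linarith
qed

theorem mainTheorem1:
  fixes V :: "'v set" and E :: "'e set" and ends :: "'e \<Rightarrow> 'v set"
  assumes "finite_graph V E ends"
  shows "\<exists>(pt :: 'v \<Rightarrow> real^3) (pl :: 'e \<Rightarrow> (real^3) list).
    graph_embedding V E ends pt pl \<and>
    (\<forall>vs1 es1 vs2 es2.
       graph_cycle V E ends vs1 es1 \<and> length vs1 = 3 \<and>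
       graph_cycle V E ends vs2 es2 \<and> length vs2 = 3 \<and>
       set vs1 \<inter> set vs2 = {} \<longrightarrow>
       linking_number (cycle_image pt pl vs1 es1) (cycle_image pt pl vs2 es2) \<noteq> 0)"
proof -
  have fin: "finite V" "finite E" and ends: "\<And>e. e \<in> E \<Longrightarrow> ends e \<subseteq> V" "\<And>e. e \<in> E \<Longrightarrow> card (ends e) = 2"
    using assms by (auto simp: finite_graph_def)
  obtain vi and n :: nat where vi: "vi ` V = {i. i < n}" "inj_on vi V"
    using finite_imp_inj_to_nat_seg[OF fin(1)] by blast
  obtain ei and m :: nat where ei: "ei ` E = {i. i < m}" "inj_on ei E"
    using finite_imp_inj_to_nat_seg[OF fin(2)] by blast
  have "\<forall>e\<in>E. \<exists>x y. ends e = {x, y} \<and> x \<noteq> y"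
    using ends(2) by (simp add: card_2_iff)
  then obtain a b where ab: "\<And>e. e \<in> E \<Longrightarrow> ends e = {a e, b e}" "\<And>e. e \<in> E \<Longrightarrow> a e \<noteq> b e"
    by metis
  define S where "S = {(i, j). i < j \<and> j < m}"
  have "S \<subseteq> {..<m} \<times> {..<m}" by (auto simp: S_def)
  then have "finite S" by (rule finite_subset) simp
  \<comment> \<open>The factor 20 exceeds 9 * 2, the largest total deviation for two triangles;
    \<open>prod_encode\<close> gives different pairs different exponents.\<close>
  then obtain ps where counts: "\<And>p. count_list ps p = (if p \<in> S then 20 * 2 ^ prod_encode p else 0)"
    using exists_list_with_counts[of S "\<lambda>p. 20 * 2 ^ prod_encode p"] by blast
  have ps_less: "i < j" if "(i, j) \<in> set ps" for i j
    using counts[of "(i, j)"] that by (auto simp: S_def count_list_0_iff split: if_splits)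
  interpret gadgets m n ps
    by unfold_locales (rule ps_less)
  define trail where "trail e = route (ei e) (vi (a e)) (vi (b e))" for e
  define rank where "rank v = vertex (vi v)" for v
  have ei_less: "ei e < m" if "e \<in> E" for e using ei(1) that by blast
  have vi_less: "vi v < n" if "v \<in> V" for v using vi(1) that by blast
  have V: "a e \<in> V" "b e \<in> V" if "e \<in> E" for e using ab(1)[OF that] ends(1)[OF that] by auto
  have rank_ends: "{vertex (vi (a e)), vertex (vi (b e))} = rank ` ends e" if "e \<in> E" for e
    by (simp add: ab(1)[OF that] rank_def)
  interpret routed_graph V E ends rank trail
  proof
    show "finite_graph V E ends" by fact
    show "inj_on rank V" using vi(2) by (auto simp: inj_on_def rank_def vertex_def)
    fix e assume e: "e \<in> E"
    have "vi (a e) \<noteq> vi (b e)" using vi(2) V[OF e] ab(2)[OF e] by (auto simp: inj_on_def)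
    then show "distinct (trail e)"
      unfolding trail_def using ei_less[OF e] vi_less V[OF e] by (intro distinct_route) auto
    show "3 \<le> length (trail e)" by (simp add: trail_def length_route)
    show "{hd (trail e), last (trail e)} = rank ` ends e"
      using rank_ends[OF e] by (simp add: trail_def)
    show "v \<in> ends e" if v: "v \<in> V" "rank v \<in> set (trail e)" for v
    proof -
      have "vi v = vi (a e) \<or> vi v = vi (b e)"
        using v vertex_in_route ei_less[OF e] vi_less[OF v(1)] unfolding rank_def trail_def by blast
      then show ?thesis using vi(2) V[OF e] v(1) ab(1)[OF e] by (auto simp: inj_on_def)
    qed
    show "set (trail e) \<inter> set (trail e') \<subseteq> rank ` ends e \<inter> rank ` ends e'" if e': "e' \<in> E" "e \<noteq> e'" for e'
    proof
      fix q assume q: "q \<in> set (trail e) \<inter> set (trail e')"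
      have "ei e \<noteq> ei e'" using ei(2) e e' by (auto simp: inj_on_def)
      then show "q \<in> rank ` ends e \<inter> rank ` ends e'"
        using route_inter[of "ei e" "ei e'" "vi (a e)" "vi (b e)" "vi (a e')" "vi (b e')" q]
          ei_less[OF e] ei_less[OF e'(1)] vi_less V[OF e] V[OF e'(1)] q
        unfolding rank_ends[OF e] rank_ends[OF e'(1)] trail_def by blast
    qed
  qed
  \<comment> \<open>Made symmetric by \<open>min\<close> and \<open>max\<close>, since the edge of
    the first triangle may come before or after that of the second in the numbering.\<close>
  define key where "key e e' = prod_encode (min (ei e) (ei e'), max (ei e) (ei e'))" for e e'
  have less: "crossings (trail e) (trail e') = 20 * 2 ^ prod_encode (ei e, ei e')"
    if "e \<in> E" "e' \<in> E" "ei e < ei e'" for e e'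
  proof -
    have "(ei e, ei e') \<in> S" using that ei_less by (auto simp: S_def)
    then show ?thesis
      unfolding trail_def using that ei_less vi_less V by (simp add: crossings_route counts)
  qed
  have close: "\<bar>crossings (trail e) (trail e') - 20 * 2 ^ key e e'\<bar> \<le> 2"
    if e: "e \<in> E" "e' \<in> E" "e \<noteq> e'" "set (trail e) \<inter> set (trail e') = {}" for e e'
  proof -
    have "ei e \<noteq> ei e'" using ei(2) e by (auto simp: inj_on_def)
    then consider "ei e < ei e'" | "ei e' < ei e" by linarith
    then show ?thesis
    proof cases
      case 1
      then show ?thesis using less[OF e(1,2) 1] by (simp add: key_def)
    next
      case 2
      have "trail e \<noteq> []" "trail e' \<noteq> []" by (simp_all add: trail_def route_def)
      then show ?thesis
        using crossings_commute_bound[of "trail e'" "trail e"] less[OF e(2,1) 2] 2 e(4)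
        by (simp add: key_def Int_commute)
    qed
  qed
  have "linking_number (cycle_image (node \<circ> rank) (map node \<circ> trail) vs1 es1)
      (cycle_image (node \<circ> rank) (map node \<circ> trail) vs2 es2) \<noteq> 0"
    if cyc: "graph_cycle V E ends vs1 es1" "length vs1 = 3" "graph_cycle V E ends vs2 es2" "length vs2 = 3"
      "set vs1 \<inter> set vs2 = {}" for vs1 es1 vs2 es2
  proof -
    obtain g1 g2 where lk: "linking_number (cycle_image (node \<circ> rank) (map node \<circ> trail) vs1 es1)
        (cycle_image (node \<circ> rank) (map node \<circ> trail) vs2 es2)
      = - (\<Sum>e\<in>set es1. \<Sum>e'\<in>set es2. direction (g1 e) e * direction (g2 e') e' * crossings (trail e) (trail e'))"
      using linking_number_cycles[OF cyc] by blast
    have es: "set es1 \<subseteq> E" "set es2 \<subseteq> E" "card (set es1) = 3" "card (set es2) = 3"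
      using cyc by (auto simp: graph_cycle_def distinct_card)
    have disj: "e \<noteq> e'" "set (trail e) \<inter> set (trail e') = {}" if "e \<in> set es1" "e' \<in> set es2" for e e'
      using closed_trail_disjoint(1)[OF cyc that] by auto
    have inj: "inj_on (\<lambda>(e, e'). key e e') (set es1 \<times> set es2)"
    proof (rule inj_onI, clarify)
      fix e e' f f' assume *: "e \<in> set es1" "e' \<in> set es2" "f \<in> set es1" "f' \<in> set es2" "key e e' = key f f'"
      then have "{ei e, ei e'} = {ei f, ei f'}"
        unfolding key_def by (auto simp: min_def max_def split: if_splits)
      moreover have "ei e \<noteq> ei f'"
        \<comment> \<open>Equal keys only identify unordered pairs. The crosswise match is
          impossible because no edge of the first triangle belongs to the second.\<close>
        using disj(1)[OF *(1,4)] ei(2) * es by (auto simp: inj_on_def)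
      ultimately have "ei e = ei f" "ei e' = ei f'" by (auto simp: doubleton_eq_iff)
      then show "e = f \<and> e' = f'" using ei(2) * es by (auto simp: inj_on_def)
    qed
    have "(\<Sum>p\<in>set es1 \<times> set es2. (case p of (e, e') \<Rightarrow> direction (g1 e) e * direction (g2 e') e') *
        (case p of (e, e') \<Rightarrow> crossings (trail e) (trail e'))) \<noteq> 0"
    proof (rule perturbed_power_sum[OF _ _ inj, where K = 20 and d = 2])
      show "set es1 \<times> set es2 \<noteq> {}" using es by auto
      fix p assume "p \<in> set es1 \<times> set es2"
      then obtain e e' where p: "p = (e, e')" "e \<in> set es1" "e' \<in> set es2" by auto
      then show "\<bar>(case p of (e, e') \<Rightarrow> crossings (trail e) (trail e')) - 20 * 2 ^ (case p of (e, e') \<Rightarrow> key e e')\<bar> \<le> 2"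
        using close[OF _ _ disj[OF p(2,3)]] es by auto
      show "\<bar>case p of (e, e') \<Rightarrow> direction (g1 e) e * direction (g2 e') e'\<bar> = 1"
        by (simp add: p direction_def)
    qed (use es in \<open>simp_all add: card_cartesian_product\<close>)
    then show ?thesis unfolding lk by (simp add: sum.cartesian_product case_prod_unfold)
  qed
  then show ?thesis using embedding by blast
qed

end
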